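(* Let $B$ be a complex Banach space which satisfies the condition $( * )$. Then $B$ has the complex Mazur-Ulam property.
   Context: For a Banach space $B$ over $\mathbb{K}=\mathbb{R}$ or $\mathbb{C}$, $S(B)$ is the unit sphere, $\operatorname{Ball}(B^* )$ the closed unit ball of the dual, $\mathbb{T}=\{z\in\mathbb{K}:|z|=1\}$, and $\mathfrak{F}_B$ the set of all maximal convex subsets of $S(B)$. Let $Q$ be the set of extreme points $q$ of $\operatorname{Ball}(B^* )$ such that $q^{-1}(1)\cap S(B)\in\mathfrak{F}_B$. For $p_1,p_2\in Q$ write $p_1\sim p_2$ if there is $\gamma\in\mathbb{T}$ with $p_1^{-1}(1)\cap S(B)=(\gamma p_2)^{-1}(1)\cap S(B)$; this is an equivalence relation on $Q$. A set of representatives for $\mathfrak{F}_B$ is a subset $P\subset Q$ containing exactly one element of each $\sim$-class. $B$ satisfies the condition $( * )$ if there exists a set of representatives $P$ for $\mathfrak{F}_B$ such that: for every $p\in P$, every $\varepsilon>0$, and every subset $F$ of $P$ that is closed in $P$ for the relative topology induced by the weak*-topology on $B^*$ with $p\notin F$, there exists $a\in S(B)$ such that $p(a)=1$ and $|q(a)|\le\varepsilon$ for all $q\in F$. A complex Banach space $B$ has the complex Mazur-Ulam property if for any complex Banach space $B'$, every surjective isometry from $S(B)$ onto $S(B')$ admits an extension to a surjective real-linear isometry from $B$ onto $B'$. *)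

theory Defs
  imports "HOL-Analysis.Analysis"
begin

text \<open>
  The real scaling inherited from \<^class>\<open>real_normed_vector\<close> is required to be the restriction of
  the complex one, so that the underlying real Banach space is the type itself.
\<close>

class complex_normed_vector = real_normed_vector +
  fixes scaleC :: "complex \<Rightarrow> 'a \<Rightarrow> 'a"  (infixr \<open>*\<^sub>C\<close> 75)
  assumes scaleC_add_right: "c *\<^sub>C (x + y) = c *\<^sub>C x + c *\<^sub>C y"
    and scaleC_add_left: "(c + d) *\<^sub>C x = c *\<^sub>C x + d *\<^sub>C x"
    and scaleC_scaleC: "c *\<^sub>C (d *\<^sub>C x) = (c * d) *\<^sub>C x"
    and scaleC_of_real: "complex_of_real r *\<^sub>C x = r *\<^sub>R x"
    and norm_scaleC: "norm (c *\<^sub>C x) = norm c * norm x"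

class complex_banach = complex_normed_vector + banach

instantiation complex :: complex_banach
begin

definition scaleC_complex :: "complex \<Rightarrow> complex \<Rightarrow> complex"
  where "scaleC_complex c x = c * x"

instance
  by standard (simp_all add: scaleC_complex_def algebra_simps norm_mult scaleR_conv_of_real)

end

text \<open>
  The complex dual is taken inside the bounded real-linear maps into \<^typ>\<open>complex\<close>; the norm there is
  the operator norm.  The topology \<^const>\<open>strong_operator_topology\<close> is the one of pointwise
  convergence, so for scalar-valued maps it is the weak* topology.
\<close>

definition complex_dual :: "('a::complex_normed_vector \<Rightarrow>\<^sub>L complex) set"
  where "complex_dual = {f. \<forall>c x. blinfun_apply f (c *\<^sub>C x) = c * blinfun_apply f x}"

definition dual_ball :: "('a::complex_normed_vector \<Rightarrow>\<^sub>L complex) set"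
  where "dual_ball = {f \<in> complex_dual. norm f \<le> 1}"

definition weak_star_topology :: "('a::complex_normed_vector \<Rightarrow>\<^sub>L complex) topology"
  where "weak_star_topology = subtopology strong_operator_topology complex_dual"

abbreviation unit_sphere :: "'a::real_normed_vector set"
  where "unit_sphere \<equiv> sphere 0 1"

definition maximal_convex_subsets :: "'a::real_normed_vector set set"
  where "maximal_convex_subsets =
    {C. convex C \<and> C \<subseteq> unit_sphere \<and>
        (\<forall>D. convex D \<and> D \<subseteq> unit_sphere \<and> C \<subseteq> D \<longrightarrow> D = C)}"

definition unit_face :: "('a::real_normed_vector \<Rightarrow> complex) \<Rightarrow> 'a set"
  where "unit_face f = f -` {1} \<inter> unit_sphere"

definition face_functionals :: "('a::complex_normed_vector \<Rightarrow>\<^sub>L complex) set"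
  where "face_functionals =
    {q. q extreme_point_of dual_ball \<and> unit_face (blinfun_apply q) \<in> maximal_convex_subsets}"

definition face_rel ::
    "(('a::complex_normed_vector \<Rightarrow>\<^sub>L complex) \<times> ('a \<Rightarrow>\<^sub>L complex)) set"
  where "face_rel =
    {(p1, p2). p1 \<in> face_functionals \<and> p2 \<in> face_functionals \<and>
       (\<exists>\<gamma>. cmod \<gamma> = 1 \<and>
          unit_face (blinfun_apply p1) = unit_face (\<lambda>a. \<gamma> * blinfun_apply p2 a))}"

lemma unit_face_rotate:
  fixes f :: "'a::complex_normed_vector \<Rightarrow>\<^sub>L complex"
  assumes "f \<in> complex_dual" "cmod \<gamma> = 1"
  shows "a \<in> unit_face (\<lambda>x. \<gamma> * blinfun_apply f x) \<longleftrightarrow> \<gamma> *\<^sub>C a \<in> unit_face (blinfun_apply f)"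
  using assms by (auto simp: unit_face_def complex_dual_def norm_scaleC)

lemma equiv_face_rel:
  "equiv face_functionals (face_rel :: (('a::complex_normed_vector \<Rightarrow>\<^sub>L complex) \<times> _) set)"
  (is "equiv _ ?R")
proof (rule equivI)
  show "?R \<subseteq> face_functionals \<times> face_functionals"
    by (auto simp: face_rel_def)
  show "refl_on face_functionals ?R"
    by (auto simp: refl_on_def face_rel_def intro!: exI [of _ 1])
  have dual: "q \<in> complex_dual" if "q \<in> face_functionals" for q :: "'a \<Rightarrow>\<^sub>L complex"
    using that by (auto simp: face_functionals_def extreme_point_of_def dual_ball_def)
  have one: "1 *\<^sub>C x = x" for x :: 'a
    using scaleC_of_real [of 1 x] by simp
  have shift: "(\<forall>a. a \<in> unit_face (blinfun_apply p) \<longleftrightarrow> \<gamma> *\<^sub>C a \<in> unit_face (blinfun_apply q)) \<longleftrightarrow>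
      unit_face (blinfun_apply p) = unit_face (\<lambda>a. \<gamma> * blinfun_apply q a)"
    if "q \<in> face_functionals" "cmod \<gamma> = 1" for p q :: "'a \<Rightarrow>\<^sub>L complex" and \<gamma>
    using unit_face_rotate [OF dual [OF that(1)] that(2)] by blast
  show "sym ?R"
  proof (rule symI)
    fix p q :: "'a \<Rightarrow>\<^sub>L complex"
    assume "(p, q) \<in> face_rel"
    then obtain \<gamma> where pq: "p \<in> face_functionals" "q \<in> face_functionals" and \<gamma>: "cmod \<gamma> = 1"
      and eq: "\<And>a. a \<in> unit_face (blinfun_apply p) \<longleftrightarrow> \<gamma> *\<^sub>C a \<in> unit_face (blinfun_apply q)"
      using shift by (fastforce simp: face_rel_def)
    have "\<gamma> \<noteq> 0" using \<gamma> by auto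
    then have "\<forall>a. a \<in> unit_face (blinfun_apply q) \<longleftrightarrow> inverse \<gamma> *\<^sub>C a \<in> unit_face (blinfun_apply p)"
      by (simp add: eq scaleC_scaleC one)
    moreover have "cmod (inverse \<gamma>) = 1" using \<gamma> by (simp add: norm_inverse)
    ultimately show "(q, p) \<in> face_rel"
      using pq shift unfolding face_rel_def by blast
  qed
  show "trans ?R"
  proof (rule transI)
    fix p q r :: "'a \<Rightarrow>\<^sub>L complex"
    assume "(p, q) \<in> face_rel" "(q, r) \<in> face_rel"
    then obtain \<gamma> \<delta> where pr: "p \<in> face_functionals" "r \<in> face_functionals"
      and n: "cmod \<gamma> = 1" "cmod \<delta> = 1"
      and eq: "\<And>a. a \<in> unit_face (blinfun_apply p) \<longleftrightarrow> \<gamma> *\<^sub>C a \<in> unit_face (blinfun_apply q)"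
        "\<And>a. a \<in> unit_face (blinfun_apply q) \<longleftrightarrow> \<delta> *\<^sub>C a \<in> unit_face (blinfun_apply r)"
      using shift by (fastforce simp: face_rel_def)
    have "\<forall>a. a \<in> unit_face (blinfun_apply p) \<longleftrightarrow> (\<delta> * \<gamma>) *\<^sub>C a \<in> unit_face (blinfun_apply r)"
      by (simp add: eq scaleC_scaleC)
    moreover have "cmod (\<delta> * \<gamma>) = 1" using n by (simp add: norm_mult)
    ultimately show "(p, r) \<in> face_rel"
      using pr shift unfolding face_rel_def by blast
  qed
qed

definition set_of_representatives :: "('a::complex_normed_vector \<Rightarrow>\<^sub>L complex) set \<Rightarrow> bool"
  where "set_of_representatives P \<longleftrightarrow>
    P \<subseteq> face_functionals \<and> (\<forall>X \<in> face_functionals // face_rel. \<exists>!p. p \<in> P \<inter> X)"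

definition condition_star :: "'a::complex_banach itself \<Rightarrow> bool"
  where "condition_star _ \<longleftrightarrow>
    (\<exists>P :: ('a \<Rightarrow>\<^sub>L complex) set. set_of_representatives P \<and>
       (\<forall>p \<in> P. \<forall>\<epsilon>>0. \<forall>F. closedin (subtopology weak_star_topology P) F \<and> p \<notin> F \<longrightarrow>
          (\<exists>a \<in> unit_sphere. blinfun_apply p a = 1 \<and> (\<forall>q \<in> F. cmod (blinfun_apply q a) \<le> \<epsilon>))))"

definition surjective_isometry_on ::
    "'a::metric_space set \<Rightarrow> 'b::metric_space set \<Rightarrow> ('a \<Rightarrow> 'b) \<Rightarrow> bool"
  where "surjective_isometry_on S S' f \<longleftrightarrow>
    f ` S = S' \<and> (\<forall>x \<in> S. \<forall>y \<in> S. dist (f x) (f y) = dist x y)"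

text \<open>
  Types cannot be quantified inside a formula, so the target space is a second argument: the space
  \<open>'a\<close> has the complex Mazur-Ulam property iff this holds with \<open>'b\<close> a free type variable
  (ranging over all complex Banach spaces).  No relation to the complex structures is imposed on the
  extension: \<^const>\<open>linear\<close> is real-linearity.
\<close>

definition complex_Mazur_Ulam_property ::
    "'a::complex_banach itself \<Rightarrow> 'b::complex_banach itself \<Rightarrow> bool"
  where "complex_Mazur_Ulam_property _ _ \<longleftrightarrow>
    (\<forall>T :: 'a \<Rightarrow> 'b. surjective_isometry_on unit_sphere unit_sphere T \<longrightarrow>
       (\<exists>L :: 'a \<Rightarrow> 'b. linear L \<and> surjective_isometry_on UNIV UNIV L \<and>
          (\<forall>x \<in> unit_sphere. L x = T x)))"

end

theory Submission
  imports Defs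
begin

text \<open>
  Let \<open>T\<close> be a surjective isometry between the unit spheres.  A maximal convex subset of a sphere
  is determined by which pairs \<open>x, y\<close> satisfy \<open>norm (x + y) = 2\<close>.  Surjective isometries preserve
  this relation (\<open>isometry_preserves_antipodal_sum\<close>), which is not immediate, as it concerns the
  distance from \<open>x\<close> to \<open>- y\<close> and \<open>T (- y)\<close> might differ from \<open>- T y\<close>.  Hence \<open>T\<close> maps
  maximal convex sets onto maximal convex sets (\<open>isometry_image_maximal_convex\<close>).  Each nonempty one
  is the part of the sphere where some extreme functional \<open>q\<close> of the dual ball equals \<open>1\<close>
  (\<open>maximal_convex_extreme_face\<close>).  In the space with the separation condition, \<open>q\<close>
  can be replaced by a representative \<open>p\<close>, at the price of replacing the value \<open>1\<close> by a unimodular \<open>\<nu>\<close>.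
  So \<open>T\<close> carries faces \<open>{p = \<nu>}\<close> to faces \<open>{q = \<mu>}\<close> of functionals \<open>q\<close> on the target.

  Fix \<open>p\<close> and take \<open>q\<close> so that \<open>{p = 1}\<close> goes to \<open>{q = 1}\<close>.  Two faces of \<open>q\<close> with values
  less than \<open>1\<close> apart are less than \<open>1\<close> apart, while separation keeps faces of different
  representatives almost \<open>1\<close> apart from some points of each other.  Walking round the circle in
  short steps shows that every face \<open>{q = \<mu>}\<close> comes from a face of the same \<open>p\<close>.  The induced map of
  the circle is an isometry fixing \<open>1\<close>, so it is a map \<open>\<sigma>\<close> which is the identity or conjugation
  (\<open>circle_face_images\<close>).

  It remains to recover the value of \<open>p\<close> at an arbitrary unit vector \<open>a\<close> from distances to faces.
  If \<open>p a = r \<nu>\<close> with \<open>r \<ge> 0\<close>, separation provides points of \<open>{p = \<nu>}\<close> at a distance from \<open>a\<close>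
  arbitrarily close to \<open>1 - r\<close> (\<open>near_own_circle_face\<close>; this is where completeness enters) and points
  of \<open>{p = - \<nu>}\<close> at a distance arbitrarily close to \<open>1 + r\<close> (\<open>near_any_circle_face\<close>).  Transporting these to the target forces \<open>q (T a) = \<sigma> (p a)\<close>
  (\<open>functional_of_image\<close>).  Since \<open>\<sigma>\<close> is real-linear and the functionals \<open>q\<close> separate the points of
  the target, the positively homogeneous extension of \<open>T\<close> is real-linear (\<open>linear_extension\<close>).
\<close>

section \<open>Isometries between unit spheres preserve maximal convex sets\<close>

lemma convex_combination_on_sphere:
  fixes x y :: "'a::real_normed_vector"
  assumes "norm x = 1" "norm y = 1" "norm (x + y) = 2" "0 \<le> t" "t \<le> 1"
  shows "norm ((1 - t) *\<^sub>R x + t *\<^sub>R y) = 1"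
proof -
  have "norm ((1 - t) *\<^sub>R x + t *\<^sub>R y) \<le> 1"
    using norm_triangle_ineq [of "(1 - t) *\<^sub>R x" "t *\<^sub>R y"] assms by simp
  moreover have "norm (t *\<^sub>R x + (1 - t) *\<^sub>R y) \<le> 1"
    using norm_triangle_ineq [of "t *\<^sub>R x" "(1 - t) *\<^sub>R y"] assms by simp
  moreover have "((1 - t) *\<^sub>R x + t *\<^sub>R y) + (t *\<^sub>R x + (1 - t) *\<^sub>R y) = x + y"
    by (simp add: algebra_simps)
  ultimately show ?thesis
    using norm_triangle_ineq [of "(1 - t) *\<^sub>R x + t *\<^sub>R y" "t *\<^sub>R x + (1 - t) *\<^sub>R y"] assms(3)
    by simp
qed

lemma convex_sphere_norm_sum:
  fixes x y :: "'a::real_normed_vector"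
  assumes "convex C" "C \<subseteq> unit_sphere" "x \<in> C" "y \<in> C"
  shows "norm (x + y) = 2"
proof -
  have "(1/2) *\<^sub>R x + (1/2) *\<^sub>R y \<in> C"
    using assms by (intro convexD) auto
  then have "norm ((1/2) *\<^sub>R (x + y)) = 1"
    using assms(2) by (auto simp: scaleR_add_right)
  then show ?thesis by simp
qed

lemma convex_Union_chain:
  assumes "\<And>X. X \<in> \<C> \<Longrightarrow> convex X" "\<And>X Y. X \<in> \<C> \<Longrightarrow> Y \<in> \<C> \<Longrightarrow> X \<subseteq> Y \<or> Y \<subseteq> X"
  shows "convex (\<Union>\<C>)"
proof (rule convexI)
  fix x y and u v :: real
  assume xy: "x \<in> \<Union>\<C>" "y \<in> \<Union>\<C>" and uv: "0 \<le> u" "0 \<le> v" "u + v = 1"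
  then obtain X Y where XY: "X \<in> \<C>" "x \<in> X" "Y \<in> \<C>" "y \<in> Y" by blast
  then obtain Z where "Z \<in> \<C>" "x \<in> Z" "y \<in> Z" using assms(2) by blast
  with assms(1) uv show "u *\<^sub>R x + v *\<^sub>R y \<in> \<Union>\<C>"
    by (meson UnionI convexD)
qed

lemma extend_to_maximal_convex:
  assumes "convex C" "C \<subseteq> unit_sphere"
  obtains D where "D \<in> maximal_convex_subsets" "C \<subseteq> D"
proof -
  let ?A = "{D. convex D \<and> D \<subseteq> unit_sphere \<and> C \<subseteq> D}"
  have "\<exists>M\<in>?A. \<forall>X\<in>?A. M \<subseteq> X \<longrightarrow> X = M"
  proof (rule subset_Zorn_nonempty)
    show "?A \<noteq> {}" using assms by blast
  next
    fix \<C> assume ne: "\<C> \<noteq> {}" and ch: "subset.chain ?A \<C>"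
    have "convex (\<Union>\<C>)"
    proof (rule convex_Union_chain)
      show "convex X" if "X \<in> \<C>" for X using ch that by (auto simp: subset.chain_def)
      show "X \<subseteq> Y \<or> Y \<subseteq> X" if "X \<in> \<C>" "Y \<in> \<C>" for X Y
        using ch that by (simp add: subset_chain_def)
    qed
    moreover have "\<Union>\<C> \<subseteq> unit_sphere" using ch by (auto simp: subset.chain_def)
    moreover have "C \<subseteq> X" if "X \<in> \<C>" for X using ch that by (auto simp: subset.chain_def)
    then have "C \<subseteq> \<Union>\<C>" using ne by blast
    ultimately show "\<Union>\<C> \<in> ?A" by simp
  qed
  then obtain M where M: "M \<in> ?A" "\<forall>X\<in>?A. M \<subseteq> X \<longrightarrow> X = M" by (rule bexE)
  have "D = M" if "convex D \<and> D \<subseteq> unit_sphere \<and> M \<subseteq> D" for D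
  proof -
    have "C \<subseteq> D" using M(1) that by auto
    then have "D \<in> ?A" using that by simp
    with M(2) have "M \<subseteq> D \<longrightarrow> D = M" by (rule bspec)
    then show ?thesis using that by (simp only: simp_thms)
  qed
  with M(1) have "M \<in> maximal_convex_subsets" by (simp add: maximal_convex_subsets_def)
  then show ?thesis using M(1) by (intro that [of M]) simp_all
qed

text \<open>
  The segments from such a point \<open>x\<close> to a maximal convex set stay on the sphere, so they can be
  adjoined to it.
\<close>
lemma maximal_convex_absorbs:
  fixes x :: "'a::real_normed_vector"
  assumes D: "D \<in> maximal_convex_subsets" and x: "x \<in> unit_sphere" and "D \<noteq> {}"
    and sum: "\<And>y. y \<in> D \<Longrightarrow> norm (x + y) = 2"
  shows "x \<in> D"
proof -
  have cD: "convex D" and sD: "D \<subseteq> unit_sphere"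
    and mx: "\<And>E. convex E \<Longrightarrow> E \<subseteq> unit_sphere \<Longrightarrow> D \<subseteq> E \<Longrightarrow> E = D"
    using D by (auto simp: maximal_convex_subsets_def)
  let ?E = "convex hull (insert x D)"
  have "?E \<subseteq> unit_sphere"
  proof
    fix z assume "z \<in> ?E"
    then obtain u v d where uv: "0 \<le> u" "0 \<le> v" "u + v = 1" and d: "d \<in> D"
      and z: "z = u *\<^sub>R x + v *\<^sub>R d"
      using convex_hull_insert [OF \<open>D \<noteq> {}\<close>, of x] hull_same [of convex D] cD by auto
    have u: "u = 1 - v" using uv by simp
    have "norm d = 1" using d sD by auto
    then have "norm z = 1"
      unfolding z u using convex_combination_on_sphere [of x d v] uv x sum [OF d] by simp
    then show "z \<in> unit_sphere" by simp
  qed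
  moreover have "D \<subseteq> ?E" using hull_subset [of "insert x D" convex] by blast
  ultimately have "?E = D" using mx [of ?E] by simp
  then show ?thesis using hull_subset [of "insert x D" convex] by blast
qed

lemma surjective_isometry_on_inv_into:
  assumes "surjective_isometry_on S S' T"
  shows "surjective_isometry_on S' S (inv_into S T)" "inj_on T S"
proof -
  have im: "T ` S = S'" and d: "\<And>x y. x \<in> S \<Longrightarrow> y \<in> S \<Longrightarrow> dist (T x) (T y) = dist x y"
    using assms by (auto simp: surjective_isometry_on_def)
  show inj: "inj_on T S"
    by (rule inj_onI) (metis d dist_eq_0_iff)
  have "inv_into S T ` S' = S" using inj im by (metis inv_into_image_cancel subset_refl)
  moreover have "dist (inv_into S T x) (inv_into S T y) = dist x y" if "x \<in> S'" "y \<in> S'" for x y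
    using that im d [of "inv_into S T x" "inv_into S T y"]
    by (simp add: f_inv_into_f inv_into_into)
  ultimately show "surjective_isometry_on S' S (inv_into S T)"
    by (auto simp: surjective_isometry_on_def)
qed

text \<open>
  If \<open>T z = - T m\<close> for an inner point \<open>m\<close> of the segment from \<open>x\<close> to \<open>y\<close>, then the convex function
  \<open>\<lambda>w. norm (w - z)\<close> attains its largest possible value \<open>2\<close> at \<open>m\<close>, hence is constantly \<open>2\<close> on the
  segment; at \<open>x\<close> this value is \<open>norm (T x + T m)\<close>.  Letting \<open>m\<close> tend to \<open>y\<close> gives the result.
\<close>
lemma isometry_preserves_antipodal_sum:
  fixes T :: "'a::real_normed_vector \<Rightarrow> 'b::real_normed_vector"
  assumes T: "surjective_isometry_on unit_sphere unit_sphere T"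
    and xy: "x \<in> unit_sphere" "y \<in> unit_sphere" "norm (x + y) = 2"
  shows "norm (T x + T y) = 2"
proof (rule antisym)
  have im: "T ` unit_sphere = unit_sphere"
    and d: "\<And>x y. x \<in> unit_sphere \<Longrightarrow> y \<in> unit_sphere \<Longrightarrow> norm (T x - T y) = norm (x - y)"
    using T by (auto simp: surjective_isometry_on_def dist_norm)
  have nT: "norm (T w) = 1" if "norm w = 1" for w using im that by auto
  show "norm (T x + T y) \<le> 2"
    using norm_triangle_ineq [of "T x" "T y"] nT xy by simp
  show "2 \<le> norm (T x + T y)"
  proof (rule field_le_epsilon)
    fix e :: real assume "e > 0"
    define s where "s = min (1/2) (e/2)"
    have s: "0 < s" "s < 1" "2 * s \<le> e" using \<open>e > 0\<close> by (auto simp: s_def)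
    define m where "m = s *\<^sub>R x + (1 - s) *\<^sub>R y"
    have m: "norm m = 1"
      using convex_combination_on_sphere [of x y "1 - s"] xy s by (simp add: m_def)
    have "- T m \<in> T ` unit_sphere" using im nT m by simp
    then obtain z where z: "norm z = 1" "T z = - T m" by auto
    have "2 = norm (T m - T z)"
      using z nT m by (simp flip: scaleR_2)
    also have "\<dots> = norm (s *\<^sub>R (x - z) + (1 - s) *\<^sub>R (y - z))"
    proof -
      have "s *\<^sub>R (x - z) + (1 - s) *\<^sub>R (y - z) = m - z"
        by (simp add: m_def algebra_simps)
      then show ?thesis using d [of m z] m z by simp
    qed
    also have "\<dots> \<le> s * norm (x - z) + (1 - s) * norm (y - z)"
      using norm_triangle_ineq [of "s *\<^sub>R (x - z)" "(1 - s) *\<^sub>R (y - z)"] s by simp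
    also have "\<dots> \<le> s * norm (x - z) + (1 - s) * 2"
      using s norm_triangle_ineq4 [of y z] xy z by (intro add_left_mono mult_left_mono) auto
    finally have "s * 2 \<le> s * norm (x - z)" by (simp add: algebra_simps)
    then have "2 \<le> norm (x - z)" using s by simp
    also have "\<dots> = norm (T x + T m)" using d [of x z] xy z by simp
    also have "\<dots> \<le> norm (T x + T y) + norm (T m - T y)"
      using norm_triangle_ineq [of "T x + T y" "T m - T y"] by simp
    also have "norm (T m - T y) = norm (s *\<^sub>R (x - y))"
      using d [of m y] xy m by (simp add: m_def algebra_simps)
    also have "\<dots> \<le> s * 2"
      using s norm_triangle_ineq4 [of x y] xy by auto
    finally show "2 \<le> norm (T x + T y) + e" using s by simp
  qed
qed

text \<open>
  Equality in the triangle inequality for an average forces equality for every term.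
\<close>
lemma norm_sum_barycentre:
  fixes y :: "'a::real_normed_vector"
  assumes F: "finite F" "F \<subseteq> unit_sphere" and y: "y \<in> unit_sphere"
    and b: "norm ((1 / card F) *\<^sub>R \<Sum>F + y) = 2" and x: "x \<in> F"
  shows "norm (x + y) = 2"
proof (rule antisym)
  have le: "norm (w + y) \<le> 2" if "w \<in> F" for w
    using norm_triangle_ineq [of w y] that F y by auto
  then show "norm (x + y) \<le> 2" using x .
  have c: "card F > 0" using F x card_gt_0_iff by blast
  have "real (card F) * 2 = norm (real (card F) *\<^sub>R ((1 / card F) *\<^sub>R \<Sum>F + y))"
    using b by simp
  also have "real (card F) *\<^sub>R ((1 / card F) *\<^sub>R \<Sum>F + y) = (\<Sum>w\<in>F. w + y)"
    using c by (simp add: scaleR_add_right sum.distrib sum_constant_scaleR)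
  also have "norm \<dots> \<le> (\<Sum>w\<in>F. norm (w + y))" by (rule norm_sum)
  also have "\<dots> = norm (x + y) + (\<Sum>w\<in>F - {x}. norm (w + y))"
    using F x by (simp add: sum.remove)
  also have "(\<Sum>w\<in>F - {x}. norm (w + y)) \<le> real (card (F - {x})) * 2"
    using le sum_bounded_above [of "F - {x}" "\<lambda>w. norm (w + y)" 2] by auto
  finally show "2 \<le> norm (x + y)"
    using F x c by (simp add: card_Diff_singleton of_nat_diff algebra_simps)
qed

text \<open>
  Any finitely many points of the image lie in a common maximal convex set \<open>D\<close>: it suffices that \<open>D\<close>
  contains the image of the barycentre \<open>u\<close> of their preimages.  Indeed \<open>norm (T u + y) = 2\<close> for all
  \<open>y \<in> D\<close>; this relation transfers back to the source, there passes from \<open>u\<close> to the points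
  averaged, and transfers forward again, so \<open>D\<close> absorbs their images.
\<close>
lemma convex_hull_isometry_image:
  fixes T :: "'a::real_normed_vector \<Rightarrow> 'b::real_normed_vector"
  assumes T: "surjective_isometry_on unit_sphere unit_sphere T"
    and C: "convex C" "C \<subseteq> unit_sphere"
  shows "convex hull (T ` C) \<subseteq> unit_sphere"
proof
  fix z assume "z \<in> convex hull (T ` C)"
  then obtain F' w where F': "finite F'" "F' \<subseteq> T ` C" and w: "\<And>x. x \<in> F' \<Longrightarrow> 0 \<le> w x" "sum w F' = 1"
    and z: "z = (\<Sum>v\<in>F'. w v *\<^sub>R v)"
    unfolding convex_hull_explicit by blast
  obtain F where F: "finite F" "F \<subseteq> C" "F' = T ` F"
    using finite_subset_image [OF F'] by blast
  have "F \<noteq> {}" using w F by auto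
  then have c: "card F > 0" using F card_gt_0_iff by blast
  define u where "u = (1 / card F) *\<^sub>R \<Sum>F"
  have "u = (\<Sum>x\<in>F. (1 / card F) *\<^sub>R x)" by (simp add: u_def scaleR_sum_right)
  also have "\<dots> \<in> C"
    using C F c by (intro convex_sum) auto
  finally have u: "u \<in> unit_sphere" using C by blast
  have sphere: "T ` unit_sphere = unit_sphere" using T by (simp add: surjective_isometry_on_def)
  then have Tu: "T u \<in> unit_sphere" using u by blast
  obtain D where D: "D \<in> maximal_convex_subsets" "{T u} \<subseteq> D"
    using extend_to_maximal_convex [of "{T u}"] Tu by auto
  then have cD: "convex D" "D \<subseteq> unit_sphere" by (auto simp: maximal_convex_subsets_def)
  have "T x \<in> D" if x: "x \<in> F" for x
  proof (rule maximal_convex_absorbs [OF D(1)])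
    have xs: "x \<in> unit_sphere" using x F C by blast
    show "T x \<in> unit_sphere" using sphere xs by blast
    show "D \<noteq> {}" using D by blast
    fix y assume y: "y \<in> D"
    then have "norm (T u + y) = 2" using convex_sphere_norm_sum [OF cD, of "T u"] D by blast
    moreover obtain v where v: "v \<in> unit_sphere" "T v = y"
    proof -
      have "y \<in> T ` unit_sphere" unfolding sphere using y cD(2) by (rule subsetD [rotated])
      then show ?thesis using that by blast
    qed
    have inv: "inv_into unit_sphere T (T t) = t" if "t \<in> unit_sphere" for t
      using surjective_isometry_on_inv_into(2) [OF T] that by (rule inv_into_f_f)
    ultimately have "norm (u + v) = 2"
      using isometry_preserves_antipodal_sum [OF surjective_isometry_on_inv_into(1) [OF T], of "T u" y]
        u v inv Tu y cD by auto
    then have "norm (x + v) = 2"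
      using norm_sum_barycentre [of F v x] F C v x unfolding u_def by auto
    then show "norm (T x + y) = 2"
      using isometry_preserves_antipodal_sum [OF T xs v(1)] v by simp
  qed
  then have "z \<in> D"
    unfolding z using F F' w cD by (intro convex_sum) auto
  then show "z \<in> unit_sphere" using cD by blast
qed

text \<open>
  Both \<open>T\<close> and its inverse map convex sets into maximal convex ones, so the image of \<open>C\<close>
  cannot be a proper part of a maximal convex set.
\<close>
lemma isometry_image_maximal_convex:
  fixes T :: "'a::real_normed_vector \<Rightarrow> 'b::real_normed_vector"
  assumes T: "surjective_isometry_on unit_sphere unit_sphere T"
    and C: "C \<in> maximal_convex_subsets"
  shows "T ` C \<in> maximal_convex_subsets"
proof -
  let ?R = "inv_into unit_sphere T"
  have R: "surjective_isometry_on unit_sphere unit_sphere ?R"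
    by (rule surjective_isometry_on_inv_into [OF T])
  have sphere: "T ` unit_sphere = unit_sphere" using T by (simp add: surjective_isometry_on_def)
  have cC: "convex C" "C \<subseteq> unit_sphere"
    and mx: "\<And>E. convex E \<Longrightarrow> E \<subseteq> unit_sphere \<Longrightarrow> C \<subseteq> E \<Longrightarrow> E = C"
    using C by (auto simp: maximal_convex_subsets_def)
  obtain D where D: "D \<in> maximal_convex_subsets" "convex hull (T ` C) \<subseteq> D"
    by (rule extend_to_maximal_convex [OF convex_convex_hull convex_hull_isometry_image [OF T cC]])
  have TC: "T ` C \<subseteq> D" using D hull_subset [of "T ` C" convex] by blast
  have cD: "convex D" "D \<subseteq> unit_sphere" using D by (auto simp: maximal_convex_subsets_def)
  have "?R ` T ` C = C"
    using surjective_isometry_on_inv_into(2) [OF T] cC by (simp add: inv_into_image_cancel)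
  then have "C \<subseteq> convex hull (?R ` D)"
    using TC hull_subset [of "?R ` D" convex] by blast
  then have "convex hull (?R ` D) = C"
    using mx convex_hull_isometry_image [OF R cD] by simp
  then have "?R ` D \<subseteq> C" using hull_subset [of "?R ` D" convex] by simp
  then have "D \<subseteq> T ` C"
  proof (intro subsetI)
    fix d assume "?R ` D \<subseteq> C" and d: "d \<in> D"
    then have "?R d \<in> C" by blast
    moreover have "d \<in> T ` unit_sphere" unfolding sphere using d cD(2) by (rule subsetD [rotated])
    then have "T (?R d) = d" by (rule f_inv_into_f)
    ultimately show "d \<in> T ` C" by (metis imageI)
  qed
  then show ?thesis using TC D by simp
qed

section \<open>Extreme linear functionals below a sublinear one\<close>

definition sublinear :: "('a::real_vector \<Rightarrow> real) \<Rightarrow> bool"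
  where "sublinear N \<longleftrightarrow> (\<forall>x y. N (x + y) \<le> N x + N y) \<and> (\<forall>r>0. \<forall>x. N (r *\<^sub>R x) \<le> r * N x)"

lemma sublinear_add: "sublinear N \<Longrightarrow> N (x + y) \<le> N x + N y"
  by (simp add: sublinear_def)

lemma sublinear_zero:
  assumes "sublinear N" shows "N 0 = 0"
proof -
  have *: "N (r *\<^sub>R 0) \<le> r * N 0" if "r > 0" for r
    using assms that unfolding sublinear_def by blast
  show ?thesis using * [of "1/2"] * [of 2] by simp
qed

lemma sublinear_scale:
  assumes N: "sublinear N" and "r \<ge> 0" shows "N (r *\<^sub>R x) = r * N x"
proof (cases "r = 0")
  case True
  then show ?thesis using sublinear_zero [OF N] by simp
next
  case False
  then have r: "r > 0" using \<open>r \<ge> 0\<close> by simp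
  then have "N (r *\<^sub>R x) \<le> r * N x" using N by (simp add: sublinear_def)
  moreover have "N (inverse r *\<^sub>R (r *\<^sub>R x)) \<le> inverse r * N (r *\<^sub>R x)"
    using N r unfolding sublinear_def by (meson positive_imp_inverse_positive)
  ultimately show ?thesis using r by (simp add: field_simps)
qed

lemma sublinear_neg: "sublinear N \<Longrightarrow> - N (- x) \<le> N x"
  using sublinear_add [of N x "- x"] sublinear_zero [of N] by simp

lemma sublinear_linear:
  assumes N: "sublinear N" and odd: "\<And>x. N (- x) \<le> - N x"
  shows "linear N"
proof (rule linearI)
  have neg: "N (- x) = - N x" for x
    using odd [of x] sublinear_neg [OF N, of x] by simp
  show "N (x + y) = N x + N y" for x y
    using sublinear_add [OF N, of x y] sublinear_add [OF N, of "- x" "- y"] neg [of x] neg [of y]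
      neg [of "x + y"] by (simp add: algebra_simps)
  show "N (r *\<^sub>R x) = r *\<^sub>R N x" for r x
    using sublinear_scale [OF N, of r x] sublinear_scale [OF N, of "- r" x] neg [of "r *\<^sub>R x"]
    by (cases "r \<ge> 0") auto
qed

text \<open>
  For a sublinear \<open>N\<close> and a nonempty convex set \<open>C\<close> on which it is constantly \<open>k\<close>, this is the support function of the face
  of all linear functionals below \<open>N\<close> that take the value \<open>k\<close> on \<open>C\<close>.
\<close>
definition tilt :: "('a::real_vector \<Rightarrow> real) \<Rightarrow> 'a set \<Rightarrow> real \<Rightarrow> 'a \<Rightarrow> real"
  where "tilt N C k y = (INF (t, c) \<in> {0..} \<times> C. N (y + t *\<^sub>R c) - t * k)"

locale constant_on_convex =
  fixes N :: "'a::real_vector \<Rightarrow> real" and C k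
  assumes sub: "sublinear N" and cvx: "convex C" and ne: "C \<noteq> {}"
    and const: "\<And>c. c \<in> C \<Longrightarrow> N c = k"
begin

text \<open>
  Subadditivity bounds each of the numbers from below by \<open>- N (- y)\<close>.
\<close>
lemma tilt_bdd: "bdd_below ((\<lambda>(t, c). N (y + t *\<^sub>R c) - t * k) ` ({0..} \<times> C))"
proof (rule bdd_belowI2)
  fix z :: "real \<times> 'a" assume "z \<in> {0..} \<times> C"
  then obtain t c where z: "z = (t, c)" "0 \<le> t" "c \<in> C" by auto
  have "N (t *\<^sub>R c) \<le> N (y + t *\<^sub>R c) + N (- y)"
    using sublinear_add [OF sub, of "y + t *\<^sub>R c" "- y"] by simp
  then show "- N (- y) \<le> (case z of (t, c) \<Rightarrow> N (y + t *\<^sub>R c) - t * k)"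
    using z const sublinear_scale [OF sub, of t c] by simp
qed

lemma tilt_le: "t \<ge> 0 \<Longrightarrow> c \<in> C \<Longrightarrow> tilt N C k y \<le> N (y + t *\<^sub>R c) - t * k"
  unfolding tilt_def using cINF_lower [OF tilt_bdd, of "(t, c)" y] by simp

lemma tilt_greatest:
  "(\<And>t c. t \<ge> 0 \<Longrightarrow> c \<in> C \<Longrightarrow> m \<le> N (y + t *\<^sub>R c) - t * k) \<Longrightarrow> m \<le> tilt N C k y"
  unfolding tilt_def using ne by (intro cINF_greatest) auto

lemma tilt_below: "tilt N C k y \<le> N y"
  using tilt_le [of 0] ne by auto

lemma tilt_neg: "c \<in> C \<Longrightarrow> tilt N C k (- c) \<le> - k"
  using tilt_le [of 1 c "- c"] sublinear_zero [OF sub] by simp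

lemma linear_le_tilt:
  assumes f: "linear f" "\<And>x. f x \<le> N x" "\<And>c. c \<in> C \<Longrightarrow> f c = k"
  shows "f y \<le> tilt N C k y"
proof (rule tilt_greatest)
  fix t :: real and c assume "c \<in> C"
  then show "f y \<le> N (y + t *\<^sub>R c) - t * k"
    using f(2) [of "y + t *\<^sub>R c"] f(3) [of c] by (simp add: linear_add [OF f(1)] linear_scale [OF f(1)])
qed

lemma tilt_eq_on:
  assumes f: "linear f" "\<And>x. f x \<le> tilt N C k x" and c: "c \<in> C"
  shows "f c = k"
  using f(2) [of c] f(2) [of "- c"] tilt_below [of c] tilt_neg [OF c] const [OF c]
  by (simp add: linear_neg [OF f(1)])

lemma sublinear_tilt: "sublinear (tilt N C k)"
  unfolding sublinear_def
proof (intro conjI allI impI)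
  fix x y
  \<comment> \<open>Convexity merges the directions \<open>c\<close> and \<open>d\<close> used for \<open>x\<close> and \<open>y\<close> into a single direction \<open>e\<close>.\<close>
  have *: "tilt N C k (x + y) - (N (x + t *\<^sub>R c) - t * k) \<le> N (y + s *\<^sub>R d) - s * k"
    if t: "t \<ge> 0" "c \<in> C" and s: "s \<ge> 0" "d \<in> C" for t c s d
  proof -
    obtain e where e: "e \<in> C" "(t + s) *\<^sub>R e = t *\<^sub>R c + s *\<^sub>R d"
    proof (cases "t + s = 0")
      case True
      then have "t = 0" "s = 0" using t s by simp_all
      then show ?thesis using t that [of c] by simp
    next
      case False
      let ?e = "(t / (t + s)) *\<^sub>R c + (s / (t + s)) *\<^sub>R d"
      have "?e \<in> C"
        using cvx t s False by (intro convexD) (auto simp: add_divide_distrib [symmetric])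
      moreover have "(t + s) *\<^sub>R ?e = t *\<^sub>R c + s *\<^sub>R d"
        using False by (simp add: scaleR_add_right)
      ultimately show ?thesis using that by blast
    qed
    have "tilt N C k (x + y) \<le> N ((x + t *\<^sub>R c) + (y + s *\<^sub>R d)) - (t + s) * k"
      using tilt_le [of "t + s" e "x + y"] t s e by (simp add: algebra_simps)
    also have "\<dots> \<le> (N (x + t *\<^sub>R c) - t * k) + (N (y + s *\<^sub>R d) - s * k)"
      using sublinear_add [OF sub, of "x + t *\<^sub>R c" "y + s *\<^sub>R d"] by (simp add: algebra_simps)
    finally show ?thesis by simp
  qed
  have "tilt N C k (x + y) - tilt N C k y \<le> N (x + t *\<^sub>R c) - t * k" if "t \<ge> 0" "c \<in> C" for t c
  proof -
    have "tilt N C k (x + y) - (N (x + t *\<^sub>R c) - t * k) \<le> tilt N C k y"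
      by (rule tilt_greatest) (rule * [OF that])
    then show ?thesis by simp
  qed
  then have "tilt N C k (x + y) - tilt N C k y \<le> tilt N C k x"
    by (rule tilt_greatest)
  then show "tilt N C k (x + y) \<le> tilt N C k x + tilt N C k y" by simp
next
  fix r :: real and x assume r: "r > 0"
  have "inverse r * tilt N C k (r *\<^sub>R x) \<le> tilt N C k x"
  proof (rule tilt_greatest)
    fix t :: real and c assume t: "t \<ge> 0" "c \<in> C"
    have "tilt N C k (r *\<^sub>R x) \<le> N (r *\<^sub>R x + (r * t) *\<^sub>R c) - (r * t) * k"
      using t r by (intro tilt_le) auto
    also have "r *\<^sub>R x + (r * t) *\<^sub>R c = r *\<^sub>R (x + t *\<^sub>R c)" by (simp add: scaleR_add_right)
    also have "N \<dots> = r * N (x + t *\<^sub>R c)" using r sublinear_scale [OF sub] by simp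
    finally show "inverse r * tilt N C k (r *\<^sub>R x) \<le> N (x + t *\<^sub>R c) - t * k"
      using r by (simp add: field_simps)
  qed
  then show "tilt N C k (r *\<^sub>R x) \<le> r * tilt N C k x"
    using r by (simp add: field_simps)
qed

end

text \<open>
  Among the linear functionals below \<open>N\<close>, those that are also below \<open>M\<close> form a face.
\<close>
definition extreme_subfunctional :: "('a::real_vector \<Rightarrow> real) \<Rightarrow> ('a \<Rightarrow> real) \<Rightarrow> bool"
  where "extreme_subfunctional N M \<longleftrightarrow>
    (\<forall>f g u. linear f \<and> linear g \<and> (\<forall>x. f x \<le> N x) \<and> (\<forall>x. g x \<le> N x) \<and> 0 < u \<and> u < 1 \<and>
       (\<forall>x. (1 - u) * f x + u * g x \<le> M x) \<longrightarrow> (\<forall>x. f x \<le> M x) \<and> (\<forall>x. g x \<le> M x))"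

text \<open>
  Tilting in the direction of one vector passes to a face of a face.  If \<open>(1 - u) f + u g\<close>
  lies below the tilted functional, it is maximal at \<open>z\<close>; hence so are \<open>f\<close> and \<open>g\<close>.
\<close>
lemma extreme_subfunctional_tilt:
  assumes M: "sublinear M" and ex: "extreme_subfunctional N M"
  shows "extreme_subfunctional N (tilt M {z} (M z))"
  unfolding extreme_subfunctional_def
proof (intro allI impI, elim conjE)
  interpret constant_on_convex M "{z}" "M z"
    by unfold_locales (use M in auto)
  fix f g :: "'a \<Rightarrow> real" and u :: real
  assume fg: "linear f" "linear g" "\<forall>x. f x \<le> N x" "\<forall>x. g x \<le> N x" and u: "0 < u" "u < 1"
    and le: "\<forall>x. (1 - u) * f x + u * g x \<le> tilt M {z} (M z) x"
  have "\<forall>x. (1 - u) * f x + u * g x \<le> M x"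
    using le tilt_below order_trans by blast
  then have fM: "f x \<le> M x" and gM: "g x \<le> M x" for x
    using ex fg u unfolding extreme_subfunctional_def by blast+
  have "linear (\<lambda>x. (1 - u) * f x + u * g x)"
    using fg by (intro linearI) (simp_all add: linear_add linear_scale algebra_simps)
  then have "(1 - u) * f z + u * g z = M z"
    using tilt_eq_on [of "\<lambda>x. (1 - u) * f x + u * g x" z] le by simp
  then have eq: "(1 - u) * (M z - f z) + u * (M z - g z) = 0"
    by (simp add: algebra_simps)
  have nn: "0 \<le> (1 - u) * (M z - f z)" "0 \<le> u * (M z - g z)"
    using fM gM u by simp_all
  then have "(1 - u) * (M z - f z) = 0" "u * (M z - g z) = 0" using eq by linarith+
  then have "f z = M z" "g z = M z" using u by simp_all
  then show "(\<forall>x. f x \<le> tilt M {z} (M z) x) \<and> (\<forall>x. g x \<le> tilt M {z} (M z) x)"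
    using linear_le_tilt [of f] linear_le_tilt [of g] fg fM gM by auto
qed

text \<open>
  Sublinear functionals stand for their sets of linear minorants, so a minimal one among those
  that cut out a face of the minorants of \<open>N\<close> plays the role of a minimal face in the proof of the
  Krein--Milman theorem.  Tilting cannot make it smaller, which forces it to be linear.  This yields
  the Hahn--Banach theorem and extremality in one application of Zorn's lemma.
\<close>
theorem extreme_linear_below_sublinear:
  assumes N: "sublinear (N :: 'a::real_vector \<Rightarrow> real)"
  shows "\<exists>f. linear f \<and> (\<forall>x. f x \<le> N x) \<and>
    (\<forall>g h u. linear g \<and> linear h \<and> (\<forall>x. g x \<le> N x) \<and> (\<forall>x. h x \<le> N x) \<and> 0 < u \<and> u < 1 \<and>
       (\<forall>x. f x = (1 - u) * g x + u * h x) \<longrightarrow> g = f \<and> h = f)"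
proof -
  define A where "A = {M. sublinear M \<and> M \<le> N \<and> extreme_subfunctional N M}"
  have "\<exists>M\<in>A. \<forall>M'\<in>A. M' \<le> M \<longrightarrow> M' = M"
  proof (rule predicate_Zorn [where P = "\<lambda>M M'. M' \<le> M"])
    show "partial_order_on A (relation_of (\<lambda>M M'. M' \<le> M) A)"
      by (rule partial_order_on_relation_ofI) auto
  next
    fix \<C> assume ch: "\<C> \<in> Chains (relation_of (\<lambda>M M'. M' \<le> M) A)"
    then have CA: "\<C> \<subseteq> A" by (auto simp: Chains_def relation_of_def)
    have lin: "M \<le> M' \<or> M' \<le> M" if "M \<in> \<C>" "M' \<in> \<C>" for M M'
      using ch that by (auto simp: Chains_def relation_of_def)
    show "\<exists>u\<in>A. \<forall>M\<in>\<C>. u \<le> M"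
    proof (cases "\<C> = {}")
      case True
      have "N \<in> A" using N by (auto simp: A_def extreme_subfunctional_def)
      with True show ?thesis by blast
    next
      case False
      define I where "I x = (INF M\<in>\<C>. M x)" for x
      have bdd: "bdd_below ((\<lambda>M. M x) ` \<C>)" for x
      proof (rule bdd_belowI2)
        fix M assume "M \<in> \<C>"
        then have "sublinear M" "M (- x) \<le> N (- x)" using CA by (auto simp: A_def le_fun_def)
        then show "- N (- x) \<le> M x" using sublinear_neg [of M x] by simp
      qed
      have I_le: "I x \<le> M x" if "M \<in> \<C>" for x M
        unfolding I_def using cINF_lower [OF bdd that] .
      have I_ge: "m \<le> I x" if "\<And>M. M \<in> \<C> \<Longrightarrow> m \<le> M x" for x m
        unfolding I_def using False that by (intro cINF_greatest) auto
      have sub: "sublinear M" if "M \<in> \<C>" for M using CA that by (auto simp: A_def)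
      have "sublinear I"
        unfolding sublinear_def
      proof (intro conjI allI impI)
        fix x y
        have "I (x + y) - M x \<le> M' y" if M: "M \<in> \<C>" "M' \<in> \<C>" for M M'
        proof -
          have "\<exists>M''\<in>\<C>. M'' x \<le> M x \<and> M'' y \<le> M' y"
            using lin [OF M] M by (metis le_funD order_refl)
          then obtain M'' where M'': "M'' \<in> \<C>" "M'' x \<le> M x" "M'' y \<le> M' y" by blast
          then show ?thesis
            using I_le [OF M''(1), of "x + y"] sublinear_add [OF sub [OF M''(1)], of x y] by simp
        qed
        then have "I (x + y) - M x \<le> I y" if "M \<in> \<C>" for M using that by (intro I_ge)
        then have "I (x + y) - I y \<le> M x" if "M \<in> \<C>" for M
          using that by (force simp: diff_le_eq add.commute)
        then have "I (x + y) - I y \<le> I x" by (rule I_ge)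
        then show "I (x + y) \<le> I x + I y" by simp
      next
        fix r :: real and x assume r: "r > 0"
        have "inverse r * I (r *\<^sub>R x) \<le> I x"
        proof (rule I_ge)
          fix M assume M: "M \<in> \<C>"
          show "inverse r * I (r *\<^sub>R x) \<le> M x"
            using I_le [OF M, of "r *\<^sub>R x"] sublinear_scale [OF sub [OF M], of r x] r
            by (simp add: field_simps)
        qed
        then show "I (r *\<^sub>R x) \<le> r * I x" using r by (simp add: field_simps)
      qed
      moreover have "I \<le> N"
      proof (rule le_funI)
        obtain M where M: "M \<in> \<C>" using False by blast
        have "M \<le> N" using CA M by (auto simp: A_def)
        then show "I x \<le> N x" for x using I_le [OF M, of x] le_funD [of M N x] by linarith
      qed
      moreover have "extreme_subfunctional N I"
        unfolding extreme_subfunctional_def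
      proof (intro allI impI, elim conjE)
        fix f g :: "'a \<Rightarrow> real" and u :: real
        assume fg: "linear f" "linear g" "\<forall>x. f x \<le> N x" "\<forall>x. g x \<le> N x" "0 < u" "u < 1"
          and le: "\<forall>x. (1 - u) * f x + u * g x \<le> I x"
        have "(\<forall>x. f x \<le> M x) \<and> (\<forall>x. g x \<le> M x)" if M: "M \<in> \<C>" for M
        proof -
          have "extreme_subfunctional N M" using CA M by (auto simp: A_def)
          moreover have "\<forall>x. (1 - u) * f x + u * g x \<le> M x" using le I_le [OF M] order_trans by blast
          ultimately show ?thesis using fg unfolding extreme_subfunctional_def by blast
        qed
        then show "(\<forall>x. f x \<le> I x) \<and> (\<forall>x. g x \<le> I x)" by (auto intro!: I_ge)
      qed
      ultimately have "I \<in> A" by (simp add: A_def)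
      then show ?thesis using I_le by (auto simp: le_fun_def)
    qed
  qed
  then obtain M where MA: "M \<in> A" and mn: "\<And>M'. M' \<in> A \<Longrightarrow> M' \<le> M \<Longrightarrow> M' = M" by blast
  then have M: "sublinear M" "M \<le> N" "extreme_subfunctional N M" by (simp_all add: A_def)
  have "M (- z) \<le> - M z" for z
  proof -
    interpret constant_on_convex M "{z}" "M z"
      by unfold_locales (use M in auto)
    have le: "tilt M {z} (M z) \<le> M" using tilt_below by (simp add: le_fun_def)
    moreover have "tilt M {z} (M z) \<le> N" using le M(2) by (rule order_trans)
    ultimately have "tilt M {z} (M z) \<in> A"
      unfolding A_def using sublinear_tilt extreme_subfunctional_tilt [OF M(1,3)] by blast
    then have "tilt M {z} (M z) = M" using le by (rule mn)
    then have "M (- z) = tilt M {z} (M z) (- z)" by (rule arg_cong [of M _ "\<lambda>F. F (- z)", OF sym])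
    also have "\<dots> \<le> - M z" by (rule tilt_neg) simp
    finally show ?thesis .
  qed
  then have linM: "linear M" by (rule sublinear_linear [OF M(1)])
  \<comment> \<open>A linear functional below a linear functional equals it, by oddness.\<close>
  have eqM: "g = M" if g: "linear g" "\<And>x. g x \<le> M x" for g
  proof
    fix x show "g x = M x"
      using g(2) [of x] g(2) [of "- x"] by (simp add: linear_neg [OF g(1)] linear_neg [OF linM])
  qed
  show ?thesis
  proof (intro exI [of _ M] conjI allI impI linM)
    show "M x \<le> N x" for x using M(2) by (rule le_funD)
    fix g h :: "'a \<Rightarrow> real" and u :: real
    assume gh: "linear g \<and> linear h \<and> (\<forall>x. g x \<le> N x) \<and> (\<forall>x. h x \<le> N x) \<and> 0 < u \<and> u < 1 \<and>
      (\<forall>x. M x = (1 - u) * g x + u * h x)"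
    then have "\<forall>x. (1 - u) * g x + u * h x \<le> M x" by simp
    then have "(\<forall>x. g x \<le> M x) \<and> (\<forall>x. h x \<le> M x)"
      using M(3) [unfolded extreme_subfunctional_def, rule_format, of g h u] gh by simp
    moreover have "linear g" "linear h" using gh by blast+
    ultimately show "g = M" "h = M" by (auto intro!: eqM)
  qed
qed

section \<open>Maximal convex sets as faces of complex functionals\<close>

lemma scaleC_one: "1 *\<^sub>C x = (x::'a::complex_normed_vector)"
  using scaleC_of_real [of 1 x] by simp

lemma scaleC_scaleR: "c *\<^sub>C (r *\<^sub>R x) = r *\<^sub>R (c *\<^sub>C (x::'a::complex_normed_vector))"
  using scaleC_scaleC [of c "of_real r" x] scaleC_scaleC [of "of_real r" c x]
  by (simp add: scaleC_of_real mult.commute)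

lemma linear_scaleC: "linear (\<lambda>x::'a::complex_normed_vector. c *\<^sub>C x)"
  by (rule linearI) (simp_all add: scaleC_add_right scaleC_scaleR)

lemma scaleC_diff_right: "c *\<^sub>C (x - y) = c *\<^sub>C x - c *\<^sub>C (y::'a::complex_normed_vector)"
  by (rule linear_diff [OF linear_scaleC])

lemma scaleC_diff_left: "(c - d) *\<^sub>C x = c *\<^sub>C x - d *\<^sub>C (x::'a::complex_normed_vector)"
  using scaleC_add_left [of "c - d" d x] by simp

lemma scaleC_inverse_cancel:
  fixes x :: "'a::complex_normed_vector"
  assumes "cmod c = 1"
  shows "c *\<^sub>C cnj c *\<^sub>C x = x" "cnj c *\<^sub>C c *\<^sub>C x = x"
proof -
  have c: "c * cnj c = 1" using assms complex_norm_square [of c] by simp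
  show "c *\<^sub>C cnj c *\<^sub>C x = x" by (simp add: scaleC_scaleC c scaleC_one)
  show "cnj c *\<^sub>C c *\<^sub>C x = x" using c by (simp add: scaleC_scaleC mult.commute scaleC_one)
qed

lemma dual_ball_scaleC: "q \<in> dual_ball \<Longrightarrow> blinfun_apply q (c *\<^sub>C x) = c * blinfun_apply q x"
  by (auto simp: dual_ball_def complex_dual_def)

lemma dual_ball_norm_le:
  assumes "q \<in> dual_ball" shows "cmod (blinfun_apply q x) \<le> norm x"
proof -
  have "norm q * norm x \<le> 1 * norm x"
    using assms by (intro mult_right_mono) (auto simp: dual_ball_def)
  then show ?thesis using norm_blinfun [of q x] by simp
qed

lemma dual_ball_Re:
  assumes q: "q \<in> dual_ball"
  shows "linear (\<lambda>x. Re (blinfun_apply q x))" "Re (blinfun_apply q x) \<le> norm x"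
  using complex_Re_le_cmod [of "blinfun_apply q x"] dual_ball_norm_le [OF q, of x]
  by (auto intro!: linearI simp: blinfun.add_right blinfun.scaleR_right)

lemma dual_ball_eqI:
  assumes "q \<in> dual_ball" "q' \<in> dual_ball" "\<And>x. Re (blinfun_apply q x) = Re (blinfun_apply q' x)"
  shows "q = q'"
proof (rule blinfun_eqI)
  fix x
  have "Re (blinfun_apply q (\<i> *\<^sub>C x)) = Re (blinfun_apply q' (\<i> *\<^sub>C x))" by (rule assms(3))
  then show "blinfun_apply q x = blinfun_apply q' x"
    using assms by (simp add: dual_ball_scaleC complex_eq_iff)
qed

lemma complexify_functional:
  fixes f :: "'a::complex_normed_vector \<Rightarrow> real"
  assumes f: "linear f" "\<And>x. f x \<le> norm x"
  obtains q where "q \<in> dual_ball" "\<And>x. Re (blinfun_apply q x) = f x"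
proof -
  define g where "g x = Complex (f x) (- f (\<i> *\<^sub>C x))" for x
  note lin = linear_add [OF f(1)] linear_scale [OF f(1)] linear_neg [OF f(1)]
  have gC: "g (c *\<^sub>C x) = c * g x" for c x
  proof -
    have a: "c *\<^sub>C x = Re c *\<^sub>R x + Im c *\<^sub>R (\<i> *\<^sub>C x)"
    proof -
      have "c = of_real (Re c) + of_real (Im c) * \<i>" by (simp add: complex_eq_iff)
      then have "c *\<^sub>C x = of_real (Re c) *\<^sub>C x + of_real (Im c) *\<^sub>C \<i> *\<^sub>C x"
        by (simp only: scaleC_add_left [symmetric] scaleC_scaleC)
      then show ?thesis by (simp only: scaleC_of_real)
    qed
    have b: "\<i> *\<^sub>C c *\<^sub>C x = Re c *\<^sub>R (\<i> *\<^sub>C x) - Im c *\<^sub>R x"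
    proof -
      have "\<i> * c = of_real (Re c) * \<i> + of_real (- Im c)" by (simp add: complex_eq_iff)
      then have "\<i> *\<^sub>C c *\<^sub>C x = of_real (Re c) *\<^sub>C \<i> *\<^sub>C x + of_real (- Im c) *\<^sub>C x"
        by (simp only: scaleC_add_left [symmetric] scaleC_scaleC)
      then show ?thesis by (simp only: scaleC_of_real) simp
    qed
    have "f (c *\<^sub>C x) = Re c * f x + Im c * f (\<i> *\<^sub>C x)" by (subst a) (simp add: lin)
    moreover have "f (\<i> *\<^sub>C c *\<^sub>C x) = Re c * f (\<i> *\<^sub>C x) - Im c * f x"
      by (subst b) (simp add: lin linear_diff [OF f(1)])
    ultimately show ?thesis by (simp add: g_def complex_eq_iff)
  qed
  have le: "cmod (g x) \<le> norm x * 1" for x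
  proof (cases "g x = 0")
    case False
    \<comment> \<open>Rotate \<open>x\<close> so that the value becomes its own real part, which \<open>f\<close> controls.\<close>
    define c where "c = cnj (sgn (g x))"
    have c: "cmod c = 1" using False by (simp add: c_def norm_sgn)
    have "c * g x = of_real (cmod (g x))"
      using False complex_norm_square [of "g x"]
      by (simp add: c_def sgn_eq field_simps power2_eq_square)
    then have "cmod (g x) = Re (g (c *\<^sub>C x))" by (simp add: gC)
    also have "\<dots> \<le> norm (c *\<^sub>C x)" by (simp add: g_def f)
    finally show ?thesis using c by (simp add: norm_scaleC)
  qed simp
  have "bounded_linear g"
    by (rule bounded_linear_intro [OF _ _ le])
      (simp_all add: g_def complex_eq_iff lin scaleC_add_right scaleC_scaleR)
  then have ap: "blinfun_apply (Blinfun g) = g" by (rule bounded_linear_Blinfun_apply)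
  have "norm (Blinfun g) \<le> 1"
    by (rule norm_blinfun_bound) (use le in \<open>auto simp: ap\<close>)
  then have "Blinfun g \<in> dual_ball" by (simp add: dual_ball_def complex_dual_def ap gC)
  then show ?thesis using that ap by (simp add: g_def)
qed

lemma convex_unit_face:
  assumes q: "q \<in> dual_ball"
  shows "convex (unit_face (blinfun_apply q))"
proof (rule convexI)
  fix x y and u v :: real
  assume xy: "x \<in> unit_face (blinfun_apply q)" "y \<in> unit_face (blinfun_apply q)"
    and uv: "0 \<le> u" "0 \<le> v" "u + v = 1"
  let ?z = "u *\<^sub>R x + v *\<^sub>R y"
  have 1: "blinfun_apply q ?z = 1"
    using xy uv by (simp add: unit_face_def blinfun.add_right blinfun.scaleR_right scaleR_conv_of_real)
      (metis of_real_1 of_real_add)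
  have "norm ?z \<le> 1"
    using norm_triangle_ineq [of "u *\<^sub>R x" "v *\<^sub>R y"] xy uv by (auto simp: unit_face_def)
  moreover have "1 \<le> norm ?z" using dual_ball_norm_le [OF q, of ?z] 1 by simp
  ultimately show "?z \<in> unit_face (blinfun_apply q)" using 1 by (simp add: unit_face_def)
qed

lemma unit_face_eq_maximal_convex:
  assumes C: "C \<in> maximal_convex_subsets" and q: "q \<in> dual_ball" "\<And>c. c \<in> C \<Longrightarrow> blinfun_apply q c = 1"
  shows "unit_face (blinfun_apply q) = C"
  using C q(2) convex_unit_face [OF q(1)]
  by (auto simp: maximal_convex_subsets_def unit_face_def)

text \<open>
  The supporting functional comes from tilting the norm along \<open>C\<close>.  An extreme linear minorant of the
  tilted norm is extreme among all real functionals of norm at most \<open>1\<close>, because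
  those that take the value \<open>1\<close> on \<open>C\<close> form a face; real parts identify these with
  the complex dual ball.
\<close>
lemma maximal_convex_extreme_face:
  fixes C :: "'a::complex_normed_vector set"
  assumes C: "C \<in> maximal_convex_subsets" and ne: "C \<noteq> {}"
  obtains q where "q extreme_point_of dual_ball" "unit_face (blinfun_apply q) = C"
proof -
  have cC: "convex C" "C \<subseteq> unit_sphere" using C by (auto simp: maximal_convex_subsets_def)
  have sub: "sublinear (norm :: 'a \<Rightarrow> real)"
    by (simp add: sublinear_def norm_triangle_ineq)
  interpret constant_on_convex norm C 1
    by unfold_locales (use cC ne sub in auto)
  obtain f where f: "linear f" "\<forall>x. f x \<le> tilt norm C 1 x"
    and ext: "\<forall>g h u. linear g \<and> linear h \<and> (\<forall>x. g x \<le> tilt norm C 1 x) \<and>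
      (\<forall>x. h x \<le> tilt norm C 1 x) \<and> 0 < u \<and> u < 1 \<and>
      (\<forall>x. f x = (1 - u) * g x + u * h x) \<longrightarrow> g = f \<and> h = f"
    using extreme_linear_below_sublinear [OF sublinear_tilt] by (elim exE conjE)
  have fC: "f c = 1" if "c \<in> C" for c using tilt_eq_on [OF f(1) _ that] f(2) by simp
  have fn: "f x \<le> norm x" for x using f(2) [THEN spec, of x] tilt_below [of x] by simp
  obtain q where q: "q \<in> dual_ball" and Req: "\<And>x. Re (blinfun_apply q x) = f x"
    using complexify_functional [OF f(1) fn] by blast
  have "blinfun_apply q c = 1" if c: "c \<in> C" for c
  proof -
    have re: "Re (blinfun_apply q c) = 1" using fC [OF c] Req by simp
    have "cmod (blinfun_apply q c) \<le> 1"
      using dual_ball_norm_le [OF q, of c] c cC by auto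
    then have "(Re (blinfun_apply q c))\<^sup>2 + (Im (blinfun_apply q c))\<^sup>2 \<le> 1"
      by (metis cmod_power2 norm_ge_zero one_power2 power2_le_imp_le power_mono)
    then show ?thesis using re by (simp add: complex_eq_iff)
  qed
  then have face: "unit_face (blinfun_apply q) = C" by (rule unit_face_eq_maximal_convex [OF C q])
  have "q extreme_point_of dual_ball"
    unfolding extreme_point_of_def
  proof (intro conjI ballI notI)
    show "q \<in> dual_ball" by (rule q)
    fix a b :: "'a \<Rightarrow>\<^sub>L complex" assume ab: "a \<in> dual_ball" "b \<in> dual_ball" and "q \<in> open_segment a b"
    then obtain u where u: "a \<noteq> b" "0 < u" "u < 1" "q = (1 - u) *\<^sub>R a + u *\<^sub>R b"
      by (auto simp: in_segment)
    let ?g = "\<lambda>x. Re (blinfun_apply a x)" and ?h = "\<lambda>x. Re (blinfun_apply b x)"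
    have comb: "f x = (1 - u) * ?g x + u * ?h x" for x
      by (simp add: Req [symmetric] u(4) blinfun.add_left blinfun.scaleR_left)
    have gh1: "?g c = 1 \<and> ?h c = 1" if "c \<in> C" for c
    proof -
      have "?g c \<le> 1" "?h c \<le> 1"
        using dual_ball_Re(2) [OF ab(1), of c] dual_ball_Re(2) [OF ab(2), of c] that cC by auto
      then have "0 \<le> (1 - u) * (1 - ?g c)" "0 \<le> u * (1 - ?h c)" using u by simp_all
      moreover have "(1 - u) * (1 - ?g c) + u * (1 - ?h c) = 0"
        using comb [of c] fC [OF that] by (simp add: algebra_simps)
      ultimately have "(1 - u) * (1 - ?g c) = 0" "u * (1 - ?h c) = 0" by linarith+
      then show ?thesis using u by simp
    qed
    have "?g x \<le> tilt norm C 1 x" "?h x \<le> tilt norm C 1 x" for x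
      using linear_le_tilt [OF dual_ball_Re(1) [OF ab(1)] dual_ball_Re(2) [OF ab(1)]]
        linear_le_tilt [OF dual_ball_Re(1) [OF ab(2)] dual_ball_Re(2) [OF ab(2)]] gh1 by simp_all
    then have "?g = f \<and> ?h = f"
      using ext [rule_format, of ?g ?h u] dual_ball_Re(1) [OF ab(1)] dual_ball_Re(1) [OF ab(2)]
        u(2,3) comb by simp
    then have "?g = ?h" by simp
    then have "a = b" using dual_ball_eqI [OF ab] by (auto dest: fun_cong)
    then show False using u by simp
  qed
  then show ?thesis using that face by blast
qed

definition circle_face :: "('a::complex_normed_vector \<Rightarrow>\<^sub>L complex) \<Rightarrow> complex \<Rightarrow> 'a set"
  where "circle_face q \<nu> = {x \<in> unit_sphere. blinfun_apply q x = \<nu>}"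

lemma circle_face_one: "circle_face q 1 = unit_face (blinfun_apply q)"
  by (auto simp: circle_face_def unit_face_def)

lemma circle_face_rotate:
  assumes "q \<in> dual_ball" "cmod c = 1" "x \<in> circle_face q \<nu>"
  shows "c *\<^sub>C x \<in> circle_face q (c * \<nu>)"
  using assms by (auto simp: circle_face_def dual_ball_scaleC norm_scaleC)

lemma maximal_convex_scaleC:
  fixes C :: "'a::complex_normed_vector set"
  assumes C: "C \<in> maximal_convex_subsets" and c: "cmod c = 1"
  shows "(\<lambda>x. c *\<^sub>C x) ` C \<in> maximal_convex_subsets"
proof (rule isometry_image_maximal_convex [OF _ C])
  have "x \<in> (\<lambda>x. c *\<^sub>C x) ` unit_sphere" if "norm x = 1" for x :: 'a
    by (rule image_eqI [of _ _ "cnj c *\<^sub>C x"])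
      (use that c in \<open>simp_all add: scaleC_inverse_cancel norm_scaleC\<close>)
  then show "surjective_isometry_on unit_sphere unit_sphere (\<lambda>x::'a. c *\<^sub>C x)"
    using c by (auto simp: surjective_isometry_on_def norm_scaleC dist_norm simp flip: scaleC_diff_right)
qed

lemma circle_face_maximal_convex:
  assumes q: "q \<in> dual_ball" and m: "unit_face (blinfun_apply q) \<in> maximal_convex_subsets"
    and \<nu>: "cmod \<nu> = 1"
  shows "circle_face q \<nu> \<in> maximal_convex_subsets"
proof -
  have "circle_face q \<nu> = (\<lambda>x. \<nu> *\<^sub>C x) ` circle_face q 1"
  proof (intro equalityI subsetI)
    fix x assume "x \<in> circle_face q \<nu>"
    then have "cnj \<nu> *\<^sub>C x \<in> circle_face q (cnj \<nu> * \<nu>)" using circle_face_rotate [OF q] \<nu> by simp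
    moreover have "cnj \<nu> * \<nu> = 1" using \<nu> by (metis complex_norm_square mult.commute of_real_1 one_power2)
    ultimately show "x \<in> (\<lambda>x. \<nu> *\<^sub>C x) ` circle_face q 1"
      using scaleC_inverse_cancel(1) [OF \<nu>, of x] by (metis imageI)
  qed (use circle_face_rotate [OF q \<nu>, of _ 1] in auto)
  then show ?thesis using maximal_convex_scaleC [OF m \<nu>] by (simp add: circle_face_one)
qed

section \<open>Consequences of the separation condition\<close>

locale separated_representatives =
  fixes P :: "('a::complex_banach \<Rightarrow>\<^sub>L complex) set"
  assumes representatives: "set_of_representatives P"
    and separation: "\<lbrakk>p \<in> P; \<epsilon> > 0; closedin (subtopology weak_star_topology P) F; p \<notin> F\<rbrakk> \<Longrightarrow>
      \<exists>a \<in> unit_sphere. blinfun_apply p a = 1 \<and> (\<forall>q \<in> F. cmod (blinfun_apply q a) \<le> \<epsilon>)"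
begin

lemma representative_face:
  assumes "p \<in> P"
  shows "p \<in> dual_ball" "unit_face (blinfun_apply p) \<in> maximal_convex_subsets"
  using assms representatives
  by (auto simp: set_of_representatives_def face_functionals_def extreme_point_of_def)

lemma norm_le_one: "p \<in> P \<Longrightarrow> cmod (blinfun_apply p x) \<le> norm x"
  using representative_face(1) dual_ball_norm_le by blast

text \<open>
  The rotation in the definition of \<^const>\<open>face_rel\<close> turns up as the unimodular value \<open>\<nu>\<close>.
\<close>
lemma maximal_convex_eq_circle_face:
  assumes C: "C \<in> maximal_convex_subsets" "C \<noteq> {}"
  obtains p \<nu> where "p \<in> P" "cmod \<nu> = 1" "C = circle_face p \<nu>"
proof -
  obtain q where q: "q extreme_point_of dual_ball" and C_eq: "unit_face (blinfun_apply q) = C"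
    using maximal_convex_extreme_face [OF C] by blast
  then have qf: "q \<in> face_functionals" using C by (simp add: face_functionals_def)
  then have "face_rel `` {q} \<in> face_functionals // face_rel" by (rule quotientI)
  then obtain p where p: "p \<in> P" "(q, p) \<in> face_rel"
    using representatives unfolding set_of_representatives_def by blast
  then obtain \<gamma> where \<gamma>: "cmod \<gamma> = 1"
    and eq: "unit_face (blinfun_apply q) = unit_face (\<lambda>a. \<gamma> * blinfun_apply p a)"
    by (auto simp: face_rel_def)
  have 1: "\<gamma> * cnj \<gamma> = 1" using \<gamma> complex_norm_square [of \<gamma>] by simp
  have "\<gamma> * z = 1 \<longleftrightarrow> z = cnj \<gamma>" for z
    using 1 by (metis mult.assoc mult.commute mult.right_neutral)
  then have "C = circle_face p (cnj \<gamma>)"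
    using C_eq eq by (auto simp: circle_face_def unit_face_def)
  then show ?thesis using \<gamma> by (intro that [OF p(1), of "cnj \<gamma>"]) simp_all
qed

text \<open>
  The normalised vector lies in some maximal convex set.
\<close>
lemma representatives_norming:
  assumes "x \<noteq> 0"
  obtains p where "p \<in> P" "cmod (blinfun_apply p x) = norm x"
proof -
  define y where "y = (1 / norm x) *\<^sub>R x"
  have y: "norm y = 1" using assms by (simp add: y_def)
  then obtain C where C: "C \<in> maximal_convex_subsets" "{y} \<subseteq> C"
    using extend_to_maximal_convex [of "{y}"] by auto
  then have "C \<noteq> {}" by blast
  then obtain p \<nu> where p: "p \<in> P" "cmod \<nu> = 1" "C = circle_face p \<nu>"
    using maximal_convex_eq_circle_face [OF C(1)] by blast
  then have "cmod (blinfun_apply p y) = 1" using C by (auto simp: circle_face_def)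
  then have "cmod (blinfun_apply p x) = norm x"
    using assms by (simp add: y_def blinfun.scaleR_right field_simps)
  then show ?thesis using that p by blast
qed

lemma norm_le_if_representatives_le:
  assumes "m \<ge> 0" "\<And>p. p \<in> P \<Longrightarrow> cmod (blinfun_apply p x) \<le> m"
  shows "norm x \<le> m"
proof (cases "x = 0")
  case False
  then obtain p where "p \<in> P" "cmod (blinfun_apply p x) = norm x" by (rule representatives_norming)
  then show ?thesis using assms(2) [of p] by simp
qed (use assms in simp)

lemma closedin_evaluation:
  assumes "closed K"
  shows "closedin (subtopology weak_star_topology P) {q \<in> P. blinfun_apply q x \<in> K}"
proof -
  have "P \<subseteq> complex_dual" using representative_face(1) by (auto simp: dual_ball_def)
  then have top: "topspace (subtopology weak_star_topology P) = P"
    by (auto simp: weak_star_topology_def strong_operator_topology_topspace)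
  have "continuous_map (subtopology weak_star_topology P) euclidean (\<lambda>q. blinfun_apply q x)"
    unfolding weak_star_topology_def
    by (intro continuous_map_from_subtopology strong_operator_topology_continuous_evaluation)
  then have "closedin (subtopology weak_star_topology P)
      {q \<in> topspace (subtopology weak_star_topology P). blinfun_apply q x \<in> K}"
    using assms by (intro closedin_continuous_map_preimage) auto
  then show ?thesis by (simp only: top)
qed

lemma separate_from_distant:
  assumes "p \<in> P" "\<epsilon> > 0" "\<delta> > 0"
  obtains u where "norm u = 1" "blinfun_apply p u = 1"
    "\<And>q. q \<in> P \<Longrightarrow> \<delta> \<le> dist (blinfun_apply q y) (blinfun_apply p y) \<Longrightarrow> cmod (blinfun_apply q u) \<le> \<epsilon>"
proof -
  have "closed {z. \<delta> \<le> dist z (blinfun_apply p y)}"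
    by (intro closed_Collect_le continuous_intros)
  then show ?thesis
    using separation [OF assms(1,2) closedin_evaluation [of "{z. \<delta> \<le> dist z (blinfun_apply p y)}" y]]
      assms that by auto
qed

lemma separate_two_points:
  assumes "p \<in> P" "q \<in> P" "p \<noteq> q" "\<epsilon> > 0"
  obtains u where "norm u = 1" "blinfun_apply p u = 1" "cmod (blinfun_apply q u) \<le> \<epsilon>"
proof -
  obtain y where y: "blinfun_apply p y \<noteq> blinfun_apply q y" using assms(3) blinfun_eqI by blast
  then have "dist (blinfun_apply q y) (blinfun_apply p y) > 0" by simp
  then show ?thesis
    using separate_from_distant [OF assms(1,4), of _ y] assms(2) that by (metis order.refl)
qed

lemma circle_face_nonempty:
  assumes "p \<in> P" "cmod \<nu> = 1"
  shows "circle_face p \<nu> \<noteq> {}"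
proof -
  obtain u where "norm u = 1" "blinfun_apply p u = 1"
    by (rule separate_from_distant [OF assms(1) zero_less_one zero_less_one, where y = 0]) blast
  then have "u \<in> circle_face p 1" by (simp add: circle_face_def)
  then have "\<nu> *\<^sub>C u \<in> circle_face p (\<nu> * 1)"
    by (rule circle_face_rotate [OF representative_face(1) [OF assms(1)] assms(2)])
  then show ?thesis by auto
qed

text \<open>
  A unit vector \<open>u\<close> peaking at \<open>p\<close> and negligible wherever \<open>q a\<close> differs noticeably from \<open>p a\<close> will do
  after rotation: at each \<open>q\<close> either \<open>q u\<close> is small or \<open>q a\<close> is close to \<open>p a\<close>.
\<close>
lemma near_any_circle_face:
  assumes p: "p \<in> P" and \<nu>: "cmod \<nu> = 1" and a: "norm a = 1" and "\<eta> > 0"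
  obtains b where "b \<in> circle_face p \<nu>" "norm (b - a) \<le> 1 + cmod (blinfun_apply p a) + \<eta>"
proof -
  obtain u where u: "norm u = 1" "blinfun_apply p u = 1"
    and far: "\<And>q. q \<in> P \<Longrightarrow> \<eta> \<le> dist (blinfun_apply q a) (blinfun_apply p a) \<Longrightarrow>
      cmod (blinfun_apply q u) \<le> \<eta>"
    using separate_from_distant [OF p \<open>\<eta> > 0\<close> \<open>\<eta> > 0\<close>] by blast
  show ?thesis
  proof (rule that)
    show "\<nu> *\<^sub>C u \<in> circle_face p \<nu>"
      using u \<nu> representative_face(1) [OF p]
      by (simp add: circle_face_def norm_scaleC dual_ball_scaleC)
    show "norm (\<nu> *\<^sub>C u - a) \<le> 1 + cmod (blinfun_apply p a) + \<eta>"
    proof (rule norm_le_if_representatives_le)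
      fix q assume q: "q \<in> P"
      have "cmod (blinfun_apply q (\<nu> *\<^sub>C u - a)) \<le> cmod (blinfun_apply q u) + cmod (blinfun_apply q a)"
        using norm_triangle_ineq4 [of "\<nu> * blinfun_apply q u" "blinfun_apply q a"] \<nu>
        by (simp add: blinfun.diff_right dual_ball_scaleC representative_face(1) [OF q] norm_mult)
      moreover have "cmod (blinfun_apply q u) \<le> 1" "cmod (blinfun_apply q a) \<le> 1"
        using norm_le_one [OF q, of u] norm_le_one [OF q, of a] u a by simp_all
      moreover have "cmod (blinfun_apply q a)
          \<le> cmod (blinfun_apply p a) + dist (blinfun_apply q a) (blinfun_apply p a)"
        by (simp add: dist_norm norm_triangle_sub)
      moreover note far [OF q] norm_ge_zero [of "blinfun_apply p a"]
      ultimately show "cmod (blinfun_apply q (\<nu> *\<^sub>C u - a)) \<le> 1 + cmod (blinfun_apply p a) + \<eta>"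
        by linarith
    qed (use \<open>\<eta> > 0\<close> in simp)
  qed
qed

text \<open>
  A single correction \<open>(1 - r) *\<^sub>R u\<close> reaches \<open>p = 1\<close> but may leave the unit ball by a small amount.
  Halving the remaining gap at each step instead keeps room of the order \<open>(1/2)^n\<close> below norm \<open>1\<close>:
  at functionals whose current value is close to that of \<open>p\<close>, the correction uses up at most
  about half of the gap, and at all others it is negligible.  Completeness provides the limit.
\<close>
lemma reach_unit_face:
  assumes p: "p \<in> P" and x: "norm x < 1" and px: "blinfun_apply p x = of_real r" and "r \<ge> 0"
  obtains s where "s \<in> circle_face p 1" "norm (s - x) \<le> 1 - r"
proof -
  define w where "w = 1 - r"
  have "r \<le> norm x" using norm_le_one [OF p, of x] px \<open>r \<ge> 0\<close> by simp
  then have w: "0 < w" "w \<le> 1" using x \<open>r \<ge> 0\<close> by (auto simp: w_def)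
  define \<kappa> where "\<kappa> = min (1/2) ((1 - norm x) / w)"
  have \<kappa>: "0 < \<kappa>" "\<kappa> \<le> 1/2" "\<kappa> * w \<le> 1 - norm x"
    using x w by (auto simp: \<kappa>_def min_def field_simps)
  \<comment> \<open>The factor \<open>\<kappa>\<close> fits the starting point \<open>x\<close> into the invariant \<open>?I\<close>, whose second half is the room
    kept below norm \<open>1\<close>.\<close>
  let ?I = "\<lambda>n y. blinfun_apply p y = of_real (1 - w * (1/2)^n) \<and> norm y \<le> 1 - \<kappa> * w * (1/2)^n"
  have "\<exists>s. \<forall>n. ?I n (s n) \<and> (n = 0 \<longrightarrow> s n = x) \<and> norm (s (Suc n) - s n) \<le> w * (1/2)^Suc n"
  proof -
    have step: "\<exists>y'. ?I (Suc n) y' \<and> norm (y' - y) \<le> w * (1/2)^Suc n" if y: "?I n y" for n y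
    proof -
      define h where "h = w * (1/2)^Suc n"
      have h: "0 < h" "2 * h \<le> 1" "w * (1/2)^n = 2 * h"
        using w power_le_one [of "1/2::real" n] mult_mono [of w 1 "(1/2::real)^n" 1]
        by (auto simp: h_def)
      have y1: "blinfun_apply p y = of_real (1 - 2 * h)" and y2: "norm y \<le> 1 - \<kappa> * (2 * h)"
        using y by (simp_all only: h(3) mult.assoc)
      obtain u where u: "norm u = 1" "blinfun_apply p u = 1"
        and far: "\<And>q. q \<in> P \<Longrightarrow> h / 2 \<le> dist (blinfun_apply q y) (blinfun_apply p y) \<Longrightarrow>
          cmod (blinfun_apply q u) \<le> \<kappa>"
        using separate_from_distant [OF p \<kappa>(1), of "h/2" y] h by auto
      have "norm (y + h *\<^sub>R u) \<le> 1 - \<kappa> * h"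
      proof (rule norm_le_if_representatives_le)
        have "\<kappa> * h \<le> 1/2 * h" using \<kappa> h by (intro mult_right_mono) auto
        then show "0 \<le> 1 - \<kappa> * h" using h(1,2) by linarith
        fix q assume q: "q \<in> P"
        have "cmod (blinfun_apply q (y + h *\<^sub>R u)) \<le> cmod (blinfun_apply q y) + h * cmod (blinfun_apply q u)"
          using norm_triangle_ineq [of "blinfun_apply q y" "h *\<^sub>R blinfun_apply q u"] h
          by (simp add: blinfun.add_right blinfun.scaleR_right)
        also have "\<dots> \<le> 1 - \<kappa> * h"
        proof (cases "h / 2 \<le> dist (blinfun_apply q y) (blinfun_apply p y)")
          case True
          then have "h * cmod (blinfun_apply q u) \<le> h * \<kappa>"
            using far [OF q] h by (intro mult_left_mono) auto
          then show ?thesis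
            using norm_le_one [OF q, of y] y2 by (simp add: algebra_simps)
        next
          case False
          have "cmod (blinfun_apply q u) \<le> 1" using norm_le_one [OF q, of u] u by simp
          then have "h * cmod (blinfun_apply q u) \<le> h * 1" using h by (intro mult_left_mono) auto
          moreover have "cmod (blinfun_apply q y)
              \<le> cmod (blinfun_apply p y) + dist (blinfun_apply q y) (blinfun_apply p y)"
            by (simp add: dist_norm norm_triangle_sub)
          moreover have "cmod (blinfun_apply p y) = 1 - 2 * h"
            unfolding y1 norm_of_real using h by simp
          ultimately show ?thesis using False \<open>\<kappa> * h \<le> 1/2 * h\<close> by simp
        qed
        finally show "cmod (blinfun_apply q (y + h *\<^sub>R u)) \<le> 1 - \<kappa> * h" .
      qed
      moreover have "blinfun_apply p (y + h *\<^sub>R u) = of_real (1 - h)"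
        using u y1 by (simp add: blinfun.add_right blinfun.scaleR_right scaleR_conv_of_real)
      moreover have "norm (y + h *\<^sub>R u - y) \<le> h" using u h by simp
      ultimately show ?thesis
        by (intro exI [of _ "y + h *\<^sub>R u"]) (simp only: h_def mult.assoc simp_thms)
    qed
    have "?I 0 x" using px \<kappa> by (simp add: w_def)
    then have "\<exists>s. \<forall>n. (?I n (s n) \<and> (n = 0 \<longrightarrow> s n = x)) \<and> norm (s (Suc n) - s n) \<le> w * (1/2)^Suc n"
      by (intro dependent_nat_choice) (simp, use step in blast)
    then show ?thesis by (simp only: conj_assoc)
  qed
  then obtain s where s: "\<And>n. blinfun_apply p (s n) = of_real (1 - w * (1/2)^n)"
    "\<And>n. norm (s n) \<le> 1 - \<kappa> * w * (1/2)^n" "s 0 = x"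
    and d: "\<And>n. norm (s (Suc n) - s n) \<le> w * (1/2)^Suc n" by blast
  have geo: "(\<lambda>n. w * (1/2)^Suc n) sums w"
    using sums_mult [OF power_half_series, of w] by simp
  have sn: "summable (\<lambda>n. norm (s (Suc n) - s n))"
    by (rule summable_comparison_test' [OF sums_summable [OF geo], of 0]) (use d in simp)
  let ?D = "\<Sum>n. s (Suc n) - s n"
  have "(\<lambda>n. \<Sum>i<n. s (Suc i) - s i) \<longlonglongrightarrow> ?D"
    using summable_LIMSEQ [OF summable_norm_cancel [OF sn]] .
  then have "(\<lambda>n. s n - x) \<longlonglongrightarrow> ?D" by (simp add: sum_lessThan_telescope s(3))
  then have lim: "s \<longlonglongrightarrow> x + ?D" using tendsto_add [OF tendsto_const [of x]] by fastforce
  have half: "(\<lambda>n. (1/2)^n) \<longlonglongrightarrow> (0::real)" by (rule LIMSEQ_power_zero) simp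
  have "(\<lambda>n. blinfun_apply p (s n)) \<longlonglongrightarrow> blinfun_apply p (x + ?D)"
    by (intro tendsto_intros lim)
  moreover have "(\<lambda>n. of_real (1 - w * (1/2)^n)) \<longlonglongrightarrow> (of_real (1 - w * 0) :: complex)"
    by (intro tendsto_intros half)
  ultimately have one: "blinfun_apply p (x + ?D) = 1"
    using s(1) LIMSEQ_unique by fastforce
  have "norm (s n) \<le> 1" for n
  proof -
    have "0 \<le> \<kappa> * w * (1/2)^n" using \<kappa>(1) w(1) by simp
    then show ?thesis using s(2) [of n] by linarith
  qed
  then have "norm (x + ?D) \<le> 1"
    by (intro LIMSEQ_le_const2 [OF tendsto_norm [OF lim]]) auto
  moreover have "1 \<le> norm (x + ?D)" using norm_le_one [OF p, of "x + ?D"] one by simp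
  ultimately have "x + ?D \<in> circle_face p 1" using one by (simp add: circle_face_def)
  moreover have "norm ?D \<le> w"
  proof -
    have "norm ?D \<le> (\<Sum>n. norm (s (Suc n) - s n))" by (rule summable_norm [OF sn])
    also have "\<dots> \<le> (\<Sum>n. w * (1/2)^Suc n)" by (rule suminf_le [OF d sn sums_summable [OF geo]])
    finally show ?thesis using sums_unique [OF geo] by simp
  qed
  ultimately show ?thesis using that by (simp add: w_def)
qed

lemma near_own_circle_face:
  assumes p: "p \<in> P" and \<nu>: "cmod \<nu> = 1" and a: "norm a = 1"
    and pa: "blinfun_apply p a = of_real r * \<nu>" "r \<ge> 0" and "\<eta> > 0"
  obtains b where "b \<in> circle_face p \<nu>" "norm (b - a) \<le> 1 - r + \<eta>"
proof -
  have pb: "p \<in> dual_ball" using representative_face(1) [OF p] .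
  have \<nu>1: "cnj \<nu> * \<nu> = 1" using \<nu> complex_norm_square [of \<nu>] by (simp add: mult.commute)
  have r: "r \<le> 1" using norm_le_one [OF p, of a] a \<nu> pa by (simp add: norm_mult)
  define t where "t = min 1 (\<eta> / 2)"
  have t: "0 < t" "t \<le> 1" "2 * t \<le> \<eta>" using \<open>\<eta> > 0\<close> by (auto simp: t_def)
  \<comment> \<open>Shrinking makes the norm smaller than \<open>1\<close>, at an arbitrarily small cost in distance.\<close>
  define x where "x = (1 - t) *\<^sub>R (cnj \<nu> *\<^sub>C a)"
  have "norm x < 1" using t \<nu> a by (simp add: x_def norm_scaleC)
  moreover have "blinfun_apply p x = of_real ((1 - t) * r)"
    using \<nu>1 pa by (simp add: x_def blinfun.scaleR_right dual_ball_scaleC [OF pb] scaleR_conv_of_real)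
  moreover have "(1 - t) * r \<ge> 0" using t pa by simp
  ultimately obtain s where s: "s \<in> circle_face p 1" "norm (s - x) \<le> 1 - (1 - t) * r"
    using reach_unit_face [OF p] by blast
  have "norm (\<nu> *\<^sub>C s - a) = norm (\<nu> *\<^sub>C (s - cnj \<nu> *\<^sub>C a))"
    using \<nu> by (simp add: scaleC_diff_right scaleC_inverse_cancel)
  also have "\<dots> = norm ((s - x) - t *\<^sub>R (cnj \<nu> *\<^sub>C a))"
    using \<nu> by (simp add: norm_scaleC x_def algebra_simps)
  also have "\<dots> \<le> norm (s - x) + t"
    using norm_triangle_ineq4 [of "s - x" "t *\<^sub>R (cnj \<nu> *\<^sub>C a)"] t \<nu> a by (simp add: norm_scaleC)
  also have "\<dots> \<le> 1 - r + \<eta>"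
  proof -
    have "t * r \<le> t" using mult_left_le [of r t] r t by simp
    moreover have "(1 - t) * r = r - t * r" by (simp add: algebra_simps)
    ultimately show ?thesis using s(2) t by linarith
  qed
  finally have "norm (\<nu> *\<^sub>C s - a) \<le> 1 - r + \<eta>" .
  moreover have "\<nu> *\<^sub>C s \<in> circle_face p \<nu>" using circle_face_rotate [OF pb \<nu> s(1)] by simp
  ultimately show ?thesis using that by blast
qed

end

section \<open>The isometry acts on each functional by a rotation or a reflection\<close>

text \<open>
  Distances to \<open>1\<close> determine real parts, and the image of \<open>\<i>\<close> decides the sign of the imaginary part.
\<close>
lemma isometry_circle_fixing_one:
  fixes s :: "complex \<Rightarrow> complex"
  assumes unit: "\<And>z. cmod z = 1 \<Longrightarrow> cmod (s z) = 1"
    and iso: "\<And>z w. cmod z = 1 \<Longrightarrow> cmod w = 1 \<Longrightarrow> dist (s z) (s w) = dist z w"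
    and one: "s 1 = 1"
  shows "(\<forall>z. cmod z = 1 \<longrightarrow> s z = z) \<or> (\<forall>z. cmod z = 1 \<longrightarrow> s z = cnj z)"
proof -
  have sq: "(Re z)\<^sup>2 + (Im z)\<^sup>2 = 1" if "cmod z = 1" for z
    using that cmod_power2 [of z] by simp
  have prod: "Re (s z) * Re (s w) + Im (s z) * Im (s w) = Re z * Re w + Im z * Im w"
    if "cmod z = 1" "cmod w = 1" for z w
  proof -
    have "(cmod (s z - s w))\<^sup>2 = (cmod (z - w))\<^sup>2" using iso [OF that] by (simp add: dist_norm)
    then show ?thesis
      using sq [of z] sq [of w] sq [of "s z"] sq [of "s w"] unit that
      by (simp add: cmod_power2 power2_diff)
  qed
  have re: "Re (s z) = Re z" if "cmod z = 1" for z
    using prod [OF that, of 1] one by simp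
  have i0: "Re (s \<i>) = 0" using re [of \<i>] by simp
  then have "(Im (s \<i>))\<^sup>2 = 1" using sq [OF unit [of \<i>]] by simp
  then consider "Im (s \<i>) = 1" | "Im (s \<i>) = -1" using power2_eq_1_iff by blast
  then show ?thesis
  proof cases
    case 1
    then have "s z = z" if "cmod z = 1" for z
      using prod [OF that, of \<i>] re [OF that] i0 by (simp add: complex_eq_iff)
    then show ?thesis by blast
  next
    case 2
    then have "s z = cnj z" if "cmod z = 1" for z
      using prod [OF that, of \<i>] re [OF that] i0 by (simp add: complex_eq_iff)
    then show ?thesis by blast
  qed
qed

text \<open>
  The powers of a fourth root of \<open>\<nu>\<close> of least argument reach \<open>\<nu>\<close> from \<open>1\<close>.  This argument is at most
  \<open>\<pi>/4 < \<pi>/3\<close>, and the chord of an arc shorter than \<open>\<pi>/3\<close> is shorter than \<open>1\<close>.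
\<close>
lemma unit_circle_short_steps:
  assumes one: "G 1"
    and step: "\<And>z w. cmod z = 1 \<Longrightarrow> cmod w = 1 \<Longrightarrow> dist z w < 1 \<Longrightarrow> G z \<Longrightarrow> G w"
    and \<nu>: "cmod \<nu> = 1"
  shows "G \<nu>"
proof -
  define c where "c = cis (Arg \<nu> / 4)"
  have c1: "cmod c = 1" by (simp add: c_def)
  have "\<bar>Arg \<nu> / 4\<bar> < pi / 3"
    using Arg_bounded [of \<nu>] pi_gt_zero by (auto simp: abs_if)
  then have "cos (pi / 3) < cos \<bar>Arg \<nu> / 4\<bar>"
    by (intro cos_monotone_0_pi) auto
  then have re: "1/2 < Re c" by (simp only: cos_abs_real) (simp add: c_def cos_60)
  have "(Re c)\<^sup>2 + (Im c)\<^sup>2 = 1" using cmod_power2 [of c] c1 by simp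
  then have "(cmod (1 - c))\<^sup>2 = 2 - 2 * Re c" by (simp add: cmod_power2 power2_diff)
  then have "(cmod (1 - c))\<^sup>2 < 1\<^sup>2" using re by simp
  then have d: "cmod (1 - c) < 1" by (rule power2_less_imp_less) simp
  have "G (c ^ n)" for n
  proof (induction n)
    case (Suc n)
    have "c ^ n - c ^ Suc n = c ^ n * (1 - c)" by (simp add: algebra_simps)
    then have "dist (c ^ n) (c ^ Suc n) < 1"
      using d c1 by (simp only: dist_norm norm_mult norm_power) simp
    then show ?case using Suc step [of "c ^ n" "c ^ Suc n"] c1 by (simp add: norm_power norm_mult)
  qed (use one in simp)
  then have "G (c ^ 4)" .
  moreover have "c ^ 4 = \<nu>"
  proof -
    have "\<nu> \<noteq> 0" using \<nu> by auto
    then show ?thesis using \<nu> by (simp add: c_def Complex.DeMoivre cis_Arg sgn_eq)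
  qed
  ultimately show ?thesis by simp
qed

locale sphere_isometry = separated_representatives P
  for P :: "('a::complex_banach \<Rightarrow>\<^sub>L complex) set" +
  fixes T :: "'a \<Rightarrow> 'b::complex_banach"
  assumes T: "surjective_isometry_on unit_sphere unit_sphere T"
begin

lemma norm_T: "norm x = 1 \<Longrightarrow> norm (T x) = 1"
  using T by (auto simp: surjective_isometry_on_def)

lemma norm_T_diff: "norm x = 1 \<Longrightarrow> norm y = 1 \<Longrightarrow> norm (T x - T y) = norm (x - y)"
  using T by (simp add: surjective_isometry_on_def dist_norm)

lemma inv_T:
  assumes "norm y = 1"
  obtains x where "norm x = 1" "T x = y"
proof -
  have "y \<in> T ` unit_sphere" using T assms by (simp add: surjective_isometry_on_def)
  then show ?thesis using that by auto
qed

lemma maximal_convex_eq_circle_face_image: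
  assumes D: "D \<in> maximal_convex_subsets" "D \<noteq> {}"
  obtains p \<nu> where "p \<in> P" "cmod \<nu> = 1" "T ` circle_face p \<nu> = D"
proof -
  let ?R = "inv_into unit_sphere T"
  have "?R ` D \<in> maximal_convex_subsets"
    by (rule isometry_image_maximal_convex [OF surjective_isometry_on_inv_into(1) [OF T] D(1)])
  then obtain p \<nu> where p: "p \<in> P" "cmod \<nu> = 1" "?R ` D = circle_face p \<nu>"
    using maximal_convex_eq_circle_face [of "?R ` D"] D(2) by blast
  have "D \<subseteq> T ` unit_sphere"
    using D(1) T by (simp add: surjective_isometry_on_def maximal_convex_subsets_def)
  then have "T ` ?R ` D = D" by (simp add: image_inv_into_cancel)
  then show ?thesis using that [OF p(1,2)] p(3) by simp
qed

text \<open>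
  On the target, rotation by \<open>\<nu>' * cnj \<nu>\<close> moves every point of one face by \<open>dist \<nu> \<nu>'\<close> into the other one.
\<close>
lemma circle_face_translate:
  assumes q: "q \<in> dual_ball"
    and eq: "T ` circle_face p s = circle_face q \<nu>" "T ` circle_face p' s' = circle_face q \<nu>'"
    and \<nu>: "cmod \<nu> = 1" "cmod \<nu>' = 1" and x: "x \<in> circle_face p s"
  obtains x' where "x' \<in> circle_face p' s'" "norm (x - x') = dist \<nu> \<nu>'"
proof -
  have Tx: "T x \<in> circle_face q \<nu>" using x eq(1) by blast
  define c where "c = \<nu>' * cnj \<nu>"
  have c: "cmod c = 1" "c * \<nu> = \<nu>'"
    using \<nu> complex_norm_square [of \<nu>] by (simp_all add: c_def norm_mult mult.assoc mult.commute)
  have "c *\<^sub>C T x \<in> circle_face q \<nu>'" using circle_face_rotate [OF q c(1) Tx] c(2) by simp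
  then obtain x' where x': "x' \<in> circle_face p' s'" "T x' = c *\<^sub>C T x"
    using eq(2) by (metis imageE)
  have "norm x = 1" "norm x' = 1" using x x'(1) by (auto simp: circle_face_def)
  then have "norm (x - x') = norm (1 *\<^sub>C T x - c *\<^sub>C T x)"
    using norm_T_diff [of x x'] x'(2) by (simp add: scaleC_one)
  also have "\<dots> = cmod (1 - c)"
    using norm_T [OF \<open>norm x = 1\<close>] by (simp add: norm_scaleC flip: scaleC_diff_left)
  also have "\<dots> = cmod ((1 - c) * \<nu>)" using \<nu> by (simp add: norm_mult)
  also have "\<dots> = dist \<nu> \<nu>'" using c by (simp add: left_diff_distrib dist_norm)
  finally show ?thesis using that x'(1) by blast
qed

text \<open>
  Faces of one functional with nearby values are closer to each other than faces of two different
  representatives can be.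
\<close>
lemma same_representative:
  assumes p: "p \<in> P" "p' \<in> P" and q: "q \<in> dual_ball"
    and eq: "T ` circle_face p s = circle_face q \<nu>" "T ` circle_face p' s' = circle_face q \<nu>'"
    and unit: "cmod \<nu> = 1" "cmod \<nu>' = 1" "cmod s = 1" "cmod s' = 1" and near: "dist \<nu> \<nu>' < 1"
  shows "p = p'"
proof (rule ccontr)
  assume "p \<noteq> p'"
  define \<epsilon> where "\<epsilon> = (1 - dist \<nu> \<nu>') / 2"
  have \<epsilon>: "\<epsilon> > 0" using near by (simp add: \<epsilon>_def)
  obtain u where u: "norm u = 1" "blinfun_apply p u = 1" "cmod (blinfun_apply p' u) \<le> \<epsilon>"
    using separate_two_points [OF p \<open>p \<noteq> p'\<close> \<epsilon>] by blast
  have "u \<in> circle_face p 1" using u by (simp add: circle_face_def)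
  then have "s *\<^sub>C u \<in> circle_face p s"
    using circle_face_rotate [OF representative_face(1) [OF p(1)] unit(3), of u 1] by simp
  then obtain x' where x': "x' \<in> circle_face p' s'" "norm (s *\<^sub>C u - x') = dist \<nu> \<nu>'"
    using circle_face_translate [OF q eq unit(1,2)] by blast
  have "1 = cmod (blinfun_apply p' x')" using x' unit by (simp add: circle_face_def)
  also have "\<dots> \<le> cmod (blinfun_apply p' (s *\<^sub>C u)) + cmod (blinfun_apply p' (s *\<^sub>C u - x'))"
    by (simp add: blinfun.diff_right norm_triangle_sub norm_minus_commute)
  also have "\<dots> \<le> \<epsilon> + dist \<nu> \<nu>'"
    using u(3) unit norm_le_one [OF p(2), of "s *\<^sub>C u - x'"] x'(2)
    by (simp add: dual_ball_scaleC [OF representative_face(1) [OF p(2)]] norm_mult)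
  also have "\<dots> < 1" using near by (simp add: \<epsilon>_def field_simps)
  finally show False by simp
qed

text \<open>
  Let \<open>s \<nu>\<close> be the value of \<open>p\<close> on the preimage of \<open>{q = \<nu>}\<close>.  The distance between two faces of one
  functional is the distance between its values, so \<open>s\<close> is an isometry of the circle; being the
  identity or conjugation, it is its own inverse and serves as \<open>\<sigma>\<close>.
\<close>
lemma circle_face_images:
  assumes p: "p \<in> P"
  obtains q \<sigma> where "q \<in> dual_ball" "\<sigma> = id \<or> \<sigma> = cnj"
    "\<And>\<nu>. cmod \<nu> = 1 \<Longrightarrow> T ` circle_face p \<nu> = circle_face q (\<sigma> \<nu>)"
proof -
  have "T ` circle_face p 1 \<in> maximal_convex_subsets"
    using isometry_image_maximal_convex [OF T] representative_face(2) [OF p] circle_face_one by metis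
  moreover have "T ` circle_face p 1 \<noteq> {}" using circle_face_nonempty [OF p] by simp
  ultimately obtain q where qe: "q extreme_point_of dual_ball"
    and q1: "circle_face q 1 = T ` circle_face p 1"
    using maximal_convex_extreme_face circle_face_one by metis
  have q: "q \<in> dual_ball" using qe by (simp add: extreme_point_of_def)
  have mq: "circle_face q \<nu> \<in> maximal_convex_subsets" if "cmod \<nu> = 1" for \<nu>
    using circle_face_maximal_convex [OF q _ that] \<open>T ` circle_face p 1 \<in> _\<close> q1 circle_face_one by metis
  have ne: "circle_face q \<nu> \<noteq> {}" if "cmod \<nu> = 1" for \<nu>
  proof -
    obtain y where "y \<in> circle_face q 1" using q1 \<open>T ` circle_face p 1 \<noteq> {}\<close> by blast
    then show ?thesis using circle_face_rotate [OF q that, of y 1] by auto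
  qed
  have all: "\<exists>s. cmod s = 1 \<and> T ` circle_face p s = circle_face q \<nu>" if "cmod \<nu> = 1" for \<nu>
    using _ _ that
  proof (rule unit_circle_short_steps)
    show "\<exists>s. cmod s = 1 \<and> T ` circle_face p s = circle_face q 1"
      using q1 by (intro exI [of _ 1]) simp
    fix z w assume zw: "cmod z = 1" "cmod w = 1" "dist z w < 1"
      and "\<exists>s. cmod s = 1 \<and> T ` circle_face p s = circle_face q z"
    then obtain s where s: "cmod s = 1" "T ` circle_face p s = circle_face q z" by blast
    obtain p' s' where p': "p' \<in> P" "cmod s' = 1" "T ` circle_face p' s' = circle_face q w"
      using maximal_convex_eq_circle_face_image [OF mq [OF zw(2)] ne [OF zw(2)]] by blast
    then have "p = p'" using same_representative [OF p p'(1) q s(2) p'(3)] zw s by blast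
    then show "\<exists>s. cmod s = 1 \<and> T ` circle_face p s = circle_face q w" using p' by blast
  qed
  then obtain s where s: "\<And>\<nu>. cmod \<nu> = 1 \<Longrightarrow> cmod (s \<nu>) = 1"
    "\<And>\<nu>. cmod \<nu> = 1 \<Longrightarrow> T ` circle_face p (s \<nu>) = circle_face q \<nu>" by metis
  have inj: "\<mu> = \<nu>" if "T ` circle_face p \<mu> = T ` circle_face p \<nu>" "cmod \<mu> = 1" for \<mu> \<nu>
  proof -
    have "circle_face p \<mu> = circle_face p \<nu>"
      using surjective_isometry_on_inv_into(2) [OF T] that(1)
      by (subst (asm) inj_on_image_eq_iff) (auto simp: circle_face_def)
    then show ?thesis using circle_face_nonempty [OF p that(2)] by (auto simp: circle_face_def)
  qed
  have "dist (s \<mu>) (s \<nu>) = dist \<mu> \<nu>" if unit: "cmod \<mu> = 1" "cmod \<nu> = 1" for \<mu> \<nu>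
  proof (rule antisym)
    obtain x where x: "x \<in> circle_face p (s \<mu>)" using circle_face_nonempty [OF p s(1) [OF unit(1)]] by blast
    obtain x' where "x' \<in> circle_face p (s \<nu>)" "norm (x - x') = dist \<mu> \<nu>"
      using circle_face_translate [OF q s(2) s(2) unit x] unit by blast
    then show "dist (s \<mu>) (s \<nu>) \<le> dist \<mu> \<nu>"
      using norm_le_one [OF p, of "x - x'"] x by (simp add: circle_face_def blinfun.diff_right dist_norm)
    have pb: "p \<in> dual_ball" by (rule representative_face(1) [OF p])
    define c where "c = s \<nu> * cnj (s \<mu>)"
    have c: "cmod c = 1" "c * s \<mu> = s \<nu>"
      using s(1) unit complex_norm_square [of "s \<mu>"]
      by (simp_all add: c_def norm_mult mult.assoc mult.commute [of "cnj (s \<mu>)"])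
    have x'': "c *\<^sub>C x \<in> circle_face p (s \<nu>)" using circle_face_rotate [OF pb c(1) x] c(2) by simp
    have nx: "norm x = 1" "norm (c *\<^sub>C x) = 1" using x x'' by (auto simp: circle_face_def)
    have "T x \<in> circle_face q \<mu>" "T (c *\<^sub>C x) \<in> circle_face q \<nu>" using s(2) unit x x'' by blast+
    then have "dist \<mu> \<nu> = cmod (blinfun_apply q (T x - T (c *\<^sub>C x)))"
      by (simp add: circle_face_def blinfun.diff_right dist_norm)
    also have "\<dots> \<le> norm (T x - T (c *\<^sub>C x))" by (rule dual_ball_norm_le [OF q])
    also have "\<dots> = norm (1 *\<^sub>C x - c *\<^sub>C x)" using norm_T_diff [OF nx] by (simp add: scaleC_one)
    also have "\<dots> = cmod (1 - c)"
      using nx by (simp add: norm_scaleC flip: scaleC_diff_left)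
    also have "\<dots> = cmod ((1 - c) * s \<mu>)" using s(1) unit by (simp add: norm_mult)
    also have "\<dots> = dist (s \<mu>) (s \<nu>)" using c by (simp add: left_diff_distrib dist_norm)
    finally show "dist \<mu> \<nu> \<le> dist (s \<mu>) (s \<nu>)" .
  qed
  moreover have "s 1 = 1" using inj [of "s 1" 1] s [of 1] q1 by simp
  ultimately consider "\<And>\<nu>. cmod \<nu> = 1 \<Longrightarrow> s \<nu> = \<nu>" | "\<And>\<nu>. cmod \<nu> = 1 \<Longrightarrow> s \<nu> = cnj \<nu>"
    using isometry_circle_fixing_one [of s] s(1) by blast
  then show ?thesis
  proof cases
    case 1
    then show ?thesis using s(2) by (intro that [OF q, of id]) auto
  next
    case 2
    have "T ` circle_face p \<nu> = circle_face q (cnj \<nu>)" if "cmod \<nu> = 1" for \<nu>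
      using 2 [of "cnj \<nu>"] s(2) [of "cnj \<nu>"] that by simp
    then show ?thesis by (intro that [OF q, of cnj]) auto
  qed
qed

text \<open>
  Let \<open>p a = r \<nu>\<close> with \<open>r \<ge> 0\<close>.  Distances from \<open>a\<close> to the faces of \<open>p\<close> with values \<open>\<nu>\<close> and \<open>- \<nu>\<close> place
  \<open>q (T a)\<close> in the discs of radii \<open>1 - r\<close> and \<open>1 + r\<close> about \<open>\<sigma> \<nu>\<close> and \<open>- \<sigma> \<nu>\<close>.  These touch in the
  single point \<open>r \<sigma> \<nu>\<close>.
\<close>
lemma functional_of_image:
  assumes p: "p \<in> P"
  obtains q \<sigma> where "q \<in> dual_ball" "\<sigma> = id \<or> \<sigma> = cnj"
    "\<And>a. norm a = 1 \<Longrightarrow> blinfun_apply q (T a) = \<sigma> (blinfun_apply p a)"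
proof -
  obtain q \<sigma> where q: "q \<in> dual_ball" and \<sigma>: "\<sigma> = id \<or> \<sigma> = cnj"
    and im: "\<And>\<nu>. cmod \<nu> = 1 \<Longrightarrow> T ` circle_face p \<nu> = circle_face q (\<sigma> \<nu>)"
    using circle_face_images [OF p] by blast
  have \<sigma>_props: "cmod (\<sigma> z) = cmod z" "\<sigma> (- z) = - \<sigma> z" "\<sigma> (of_real t * z) = of_real t * \<sigma> z" for z t
    using \<sigma> by auto
  have "blinfun_apply q (T a) = \<sigma> (blinfun_apply p a)" if a: "norm a = 1" for a
  proof -
    define r where "r = cmod (blinfun_apply p a)"
    define \<nu> where "\<nu> = (if blinfun_apply p a = 0 then 1 else sgn (blinfun_apply p a))"
    have \<nu>: "cmod \<nu> = 1" by (simp add: \<nu>_def norm_sgn)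
    have pa: "blinfun_apply p a = of_real r * \<nu>" by (simp add: \<nu>_def r_def sgn_eq)
    have r: "r \<ge> 0" by (simp add: r_def)
    define Q where "Q = blinfun_apply q (T a)"
    define m where "m = \<sigma> \<nu>"
    have close: "cmod (\<sigma> \<mu> - Q) \<le> norm (b - a)" if "b \<in> circle_face p \<mu>" "cmod \<mu> = 1" for b \<mu>
    proof -
      have "T b \<in> circle_face q (\<sigma> \<mu>)" using im that by blast
      then have "\<sigma> \<mu> - Q = blinfun_apply q (T b - T a)"
        by (simp add: circle_face_def Q_def blinfun.diff_right)
      then show ?thesis
        using dual_ball_norm_le [OF q, of "T b - T a"] norm_T_diff [of b a] that a
        by (simp add: circle_face_def)
    qed
    have near: "cmod (m - Q) \<le> 1 - r"
    proof (rule field_le_epsilon)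
      fix e :: real assume "e > 0"
      then obtain b where "b \<in> circle_face p \<nu>" "norm (b - a) \<le> 1 - r + e"
        using near_own_circle_face [OF p \<nu> a pa r] by blast
      then show "cmod (m - Q) \<le> 1 - r + e" using close [of b \<nu>] \<nu> by (simp add: m_def)
    qed
    have far: "cmod (- m - Q) \<le> 1 + r"
    proof (rule field_le_epsilon)
      fix e :: real assume "e > 0"
      then obtain b where "b \<in> circle_face p (- \<nu>)" "norm (b - a) \<le> 1 + r + e"
        using near_any_circle_face [OF p, of "- \<nu>" a e] \<nu> a by (auto simp: r_def)
      then show "cmod (- m - Q) \<le> 1 + r + e"
        using close [of b "- \<nu>"] \<nu> by (simp add: m_def \<sigma>_props)
    qed
    have m1: "cmod m = 1" using \<nu> by (simp add: m_def \<sigma>_props)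
    define Z where "Z = cnj m * Q"
    have mm: "cnj m * m = 1" using m1 complex_norm_square [of m] by (simp add: mult.commute)
    have "cmod (1 - Z) = cmod (m - Q)"
    proof -
      have "1 - Z = cnj m * (m - Q)" by (simp add: Z_def mm right_diff_distrib)
      then show ?thesis using m1 by (simp add: norm_mult)
    qed
    moreover have "cmod (1 + Z) = cmod (- m - Q)"
    proof -
      have "1 + Z = - cnj m * (- m - Q)" using mm by (simp add: Z_def right_diff_distrib)
      then show ?thesis using m1 by (simp only: norm_mult norm_minus_cancel) simp
    qed
    ultimately have le: "cmod (1 - Z) \<le> 1 - r" "cmod (1 + Z) \<le> 1 + r" using near far by simp_all
    then have "Re Z = r"
      using complex_Re_le_cmod [of "1 - Z"] complex_Re_le_cmod [of "1 + Z"] by simp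
    moreover have "(cmod (1 - Z))\<^sup>2 \<le> (1 - r)\<^sup>2" using le(1) by (intro power_mono) auto
    ultimately have "Z = of_real r" by (simp add: cmod_power2 complex_eq_iff)
    then have "m * of_real r = m * (cnj m * Q)" by (simp only: Z_def)
    also have "\<dots> = (cnj m * m) * Q" by (simp only: mult_ac)
    finally have "Q = m * of_real r" using mm by simp
    then show ?thesis by (simp add: Q_def pa m_def \<sigma>_props mult.commute [of "\<sigma> \<nu>"])
  qed
  then show ?thesis using that [OF q \<sigma>] by blast
qed

text \<open>
  The functionals obtained on the target separate its points, so the homogeneous extension inherits
  real-linearity from the identities \<open>q (T a) = \<sigma> (p a)\<close>.
\<close>
theorem linear_extension:
  "\<exists>L. linear L \<and> surjective_isometry_on UNIV UNIV L \<and> (\<forall>x\<in>unit_sphere. L x = T x)"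
proof -
  have "\<forall>p\<in>P. \<exists>q \<sigma>. q \<in> dual_ball \<and> (\<sigma> = id \<or> \<sigma> = cnj) \<and>
      (\<forall>a. norm a = 1 \<longrightarrow> blinfun_apply q (T a) = \<sigma> (blinfun_apply p a))"
    using functional_of_image by metis
  then obtain q \<sigma> where q: "\<And>p. p \<in> P \<Longrightarrow> q p \<in> dual_ball"
    and \<sigma>: "\<And>p. p \<in> P \<Longrightarrow> \<sigma> p = id \<or> \<sigma> p = cnj"
    and qT: "\<And>p a. p \<in> P \<Longrightarrow> norm a = 1 \<Longrightarrow> blinfun_apply (q p) (T a) = \<sigma> p (blinfun_apply p a)"
    by metis
  have \<sigma>_add: "\<sigma> p (z + w) = \<sigma> p z + \<sigma> p w" and \<sigma>_scale: "\<sigma> p (t *\<^sub>R z) = t *\<^sub>R \<sigma> p z"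
    and \<sigma>_norm: "cmod (\<sigma> p z) = cmod z" if "p \<in> P" for p t z w
    using \<sigma> [OF that] by (auto simp: complex_cnj_scaleR)
  define L where "L x = norm x *\<^sub>R T ((1 / norm x) *\<^sub>R x)" for x
  have qL: "blinfun_apply (q p) (L x) = \<sigma> p (blinfun_apply p x)" if p: "p \<in> P" for p x
  proof (cases "x = 0")
    case True
    then show ?thesis using \<sigma>_scale [OF p, of 0 0] by (simp add: L_def)
  next
    case False
    then have "blinfun_apply (q p) (L x) = norm x *\<^sub>R \<sigma> p (blinfun_apply p ((1 / norm x) *\<^sub>R x))"
      using qT [OF p] by (simp add: L_def blinfun.scaleR_right)
    also have "\<dots> = \<sigma> p (blinfun_apply p x)"
      using False by (simp add: blinfun.scaleR_right \<sigma>_scale [OF p])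
    finally show ?thesis .
  qed
  have separating: "y = z" if eq: "\<And>p. p \<in> P \<Longrightarrow> blinfun_apply (q p) y = blinfun_apply (q p) z" for y z
  proof (rule ccontr)
    assume "y \<noteq> z"
    define w where "w = (1 / norm (y - z)) *\<^sub>R (y - z)"
    have "norm w = 1" using \<open>y \<noteq> z\<close> by (simp add: w_def)
    then obtain a where a: "norm a = 1" "T a = w" by (rule inv_T)
    then have "a \<noteq> 0" by auto
    then obtain p where p: "p \<in> P" "cmod (blinfun_apply p a) = norm a" by (rule representatives_norming)
    have "blinfun_apply (q p) w = 0"
      using eq [OF p(1)] by (simp add: w_def blinfun.scaleR_right blinfun.diff_right)
    then show False using qT [OF p(1) a(1)] a p \<sigma>_norm [OF p(1)] by (metis norm_zero zero_neq_one)
  qed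
  have linL: "linear L"
  proof (rule linearI)
    show "L (x + y) = L x + L y" for x y
      by (rule separating) (simp add: qL blinfun.add_right \<sigma>_add)
    show "L (t *\<^sub>R x) = t *\<^sub>R L x" for t x
      by (rule separating) (simp add: qL blinfun.scaleR_right \<sigma>_scale)
  qed
  have "norm (L x) = norm x" for x
    using norm_T [of "(1 / norm x) *\<^sub>R x"] by (cases "x = 0") (simp_all add: L_def)
  then have "dist (L x) (L y) = dist x y" for x y
    by (simp add: dist_norm flip: linear_diff [OF linL])
  moreover have LT: "L x = T x" if "norm x = 1" for x using that by (simp add: L_def)
  moreover have "y \<in> range L" for y
  proof (cases "y = 0")
    case True
    then show ?thesis using linear_0 [OF linL] by (metis rangeI)
  next
    case False
    then have "norm ((1 / norm y) *\<^sub>R y) = 1" by simp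
    then obtain x where x: "norm x = 1" "T x = (1 / norm y) *\<^sub>R y" by (rule inv_T)
    then have "L (norm y *\<^sub>R x) = y" using False LT by (simp add: linear_scale [OF linL])
    then show ?thesis by (metis rangeI)
  qed
  then have "range L = UNIV" by blast
  ultimately show ?thesis using linL by (auto simp: surjective_isometry_on_def intro!: exI [of _ L])
qed

end

theorem theorem6p3:
  assumes "condition_star TYPE('a::complex_banach)"
  shows "complex_Mazur_Ulam_property TYPE('a) TYPE('b::complex_banach)"
proof -
  obtain P :: "('a \<Rightarrow>\<^sub>L complex) set" where P: "set_of_representatives P"
    and sep: "\<forall>p \<in> P. \<forall>\<epsilon>>0. \<forall>F. closedin (subtopology weak_star_topology P) F \<and> p \<notin> F \<longrightarrow>
      (\<exists>a \<in> unit_sphere. blinfun_apply p a = 1 \<and> (\<forall>q \<in> F. cmod (blinfun_apply q a) \<le> \<epsilon>))"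
    using assms unfolding condition_star_def by blast
  have "separated_representatives P"
    by unfold_locales (use P sep in blast)+
  then have "sphere_isometry P T"
    if "surjective_isometry_on unit_sphere unit_sphere T" for T :: "'a \<Rightarrow> 'b"
    using that by (simp add: sphere_isometry_def sphere_isometry_axioms_def)
  then show ?thesis
    unfolding complex_Mazur_Ulam_property_def using sphere_isometry.linear_extension by blast
qed

end
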